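(* Let $E$ be a reflexive, locally uniformly convex real Banach space with topological dual $E^*$, and let $\tau$ be an admissible topology on $E$ (as defined in the context). Let $X$ be a paracompact topological space and $A:X\to E^*$ a weakly continuous operator. Assume that there exist a number $r>0$, a continuous function $\alpha:X\to\mathbb{R}$ satisfying $$|\alpha(x)|\leq r\|A(x)\|_{E^*}\quad\text{for all }x\in X,$$ a closed set $C\subset X$, and a $\tau$-continuous function $g:C\to B_r$ satisfying $$A(x)(g(x))=\alpha(x)\quad\text{for all }x\in C,$$ in such a way that, for every $\tau$-continuous function $\psi:X\to B_r$ satisfying $\psi_{|C}=g$, there exists $x_0\in X$ such that $$A(x_0)(\psi(x_0))\neq\alpha(x_0).$$ Then there exists $x^*\in X$ such that $A(x^* )=0$.
   Context: For $r>0$, $B_r=\{x\in E:\|x\|\leq r\}$. The space $E$ is locally uniformly convex if for each $x\in E$ with $\|x\|=1$ and each $\epsilon>0$ there exists $\delta>0$ such that, for every $y\in E$ with $\|y\|=1$ and $\|x-y\|\geq\epsilon$, one has $\|x+y\|\leq 2(1-\delta)$. A topology $\tau$ on $E$ is called admissible here if: it is weaker than (or equal to) the strong (norm) topology and stronger than (or equal to) the weak topology; $(E,\tau)$ is a Hausdorff locally convex topological vector space; the $\tau$-closed convex hull of any $\tau$-compact subset of $E$ is $\tau$-compact; and the relativization of $\tau$ to $B_1$ is metrizable by a complete metric. (Examples: the strong topology; the weak topology if $E$ is separable.) A function with values in $B_r$ is $\tau$-continuous if it is continuous when $B_r$ carries the relativization of $\tau$. The operator $A:X\to E^*$ is weakly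 continuous if it is continuous from $X$ to $E^*$ with the weak topology; since $E$ is reflexive, this means that $x\mapsto A(x)(y)$ is continuous on $X$ for every $y\in E$. Paracompact spaces are understood, as usual in this setting, to be Hausdorff. *)

theory Defs
  imports "HOL-Analysis.Analysis"
begin

definition reflexive_space :: "'a::real_normed_vector itself \<Rightarrow> bool" where
  "reflexive_space (_ :: 'a itself) \<longleftrightarrow>
     (\<forall>\<phi> :: ('a \<Rightarrow>\<^sub>L real) \<Rightarrow>\<^sub>L real. \<exists>x :: 'a. \<forall>f. blinfun_apply \<phi> f = blinfun_apply f x)"

definition locally_uniformly_convex :: "'a::real_normed_vector itself \<Rightarrow> bool" where
  "locally_uniformly_convex (_ :: 'a itself) \<longleftrightarrow>
     (\<forall>x :: 'a. \<forall>\<epsilon>>0. norm x = 1 \<longrightarrow>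
        (\<exists>\<delta>>0. \<forall>y. norm y = 1 \<and> norm (x - y) \<ge> \<epsilon> \<longrightarrow> norm (x + y) \<le> 2 * (1 - \<delta>)))"

text \<open>
  At a dual space \<open>'a \<Rightarrow>\<^sub>L real\<close> the functionals range over the bidual, so this is the weak
  topology there, not the weak-star topology.
\<close>

definition weak_topology :: "'a::real_normed_vector topology" where
  "weak_topology =
     topology_generated_by {blinfun_apply f -` U | (f :: 'a \<Rightarrow>\<^sub>L real) U. open U}"

definition Hausdorff_lctvs :: "'a::real_vector topology \<Rightarrow> bool" where
  "Hausdorff_lctvs \<tau> \<longleftrightarrow>
     topspace \<tau> = UNIV \<and>
     continuous_map (prod_topology \<tau> \<tau>) \<tau> (\<lambda>(x, y). x + y) \<and>
     continuous_map (prod_topology euclideanreal \<tau>) \<tau> (\<lambda>(c, x). c *\<^sub>R x) \<and>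
     neighbourhood_base_of convex \<tau> \<and>
     Hausdorff_space \<tau>"

definition admissible_topology :: "'a::real_normed_vector topology \<Rightarrow> bool" where
  "admissible_topology \<tau> \<longleftrightarrow>
     (\<forall>U. openin \<tau> U \<longrightarrow> open U) \<and>
     (\<forall>U. openin weak_topology U \<longrightarrow> openin \<tau> U) \<and>
     Hausdorff_lctvs \<tau> \<and>
     (\<forall>K. compactin \<tau> K \<longrightarrow> compactin \<tau> (\<tau> closure_of (convex hull K))) \<and>
     completely_metrizable_space (subtopology \<tau> (cball 0 1))"

definition paracompact_space :: "'a topology \<Rightarrow> bool" where
  "paracompact_space X \<longleftrightarrow>
     Hausdorff_space X \<and>
     (\<forall>\<U>. (\<forall>U\<in>\<U>. openin X U) \<and> \<Union>\<U> = topspace X \<longrightarrow>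
        (\<exists>\<V>. (\<forall>V\<in>\<V>. openin X V) \<and> \<Union>\<V> = topspace X \<and>
             (\<forall>V\<in>\<V>. \<exists>U\<in>\<U>. V \<subseteq> U) \<and> locally_finite_in X \<V>))"

end

theory Submission
  imports Defs
begin

text \<open>
  Suppose that \<open>A x\<close> vanishes nowhere. The slice \<open>\<Phi> x = {y. norm y \<le> r \<and> A x y = \<alpha> x}\<close> is then a
  nonempty closed convex subset of the ball, and the theorem follows once \<open>g\<close> is extended to a
  \<open>\<tau>\<close>-continuous selection \<open>\<psi>\<close> of \<open>\<Phi>\<close>, because such a \<open>\<psi>\<close> is exactly what the last hypothesis excludes.

  Nonemptiness holds because functionals on a reflexive space attain their norm
  (\<open>reflexive_norm_attained\<close>). The multimap \<open>\<Phi>\<close> is lower semicontinuous even for the norm topology,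
  hence for \<open>\<tau>\<close> (\<open>hyperplane_ball_lsc\<close>). The only delicate point \<open>y\<close> of a slice is one where \<open>A x\<close>
  attains its norm: there \<open>A\<close> is merely weakly continuous, so for nearby \<open>x'\<close> the norm of \<open>A x'\<close> may
  exceed that of \<open>A x\<close>. Moving from \<open>y\<close> towards a maximizer \<open>z\<close> of \<open>A x'\<close> still reaches the slice
  after a short distance: if \<open>z\<close> is close to \<open>y\<close> this is clear, and if it is not, local uniform
  convexity keeps \<open>y + z\<close> short, which forces \<open>A x'\<close> to increase steeply along the segment
  (\<open>hyperplane_ball_lower_stable_above\<close>). Replacing \<open>\<Phi> x\<close> by \<open>{g x}\<close> on the closed set \<open>C\<close> preserves
  lower semicontinuity for \<open>\<tau>\<close> (\<open>lsc_multimap_prescribe\<close>).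

  It remains to select continuously, by Michael's method: partitions of unity give approximate
  selections, and successive corrections converge (\<open>convex_selection\<close>). A metric on the unit ball
  need not have convex balls, so the approximation is controlled by convex neighbourhoods of the origin
  instead. First countability of the ball yields a sequence \<open>V n\<close> of these that, by translation,
  describes the topology uniformly on the ball (\<open>lctvs_countable_base_on_ball\<close>). A sequence in the
  ball that is Cauchy for the \<open>V n\<close> is weakly Cauchy, so by reflexivity it has a weak limit, and since
  weak limits of sequences in a convex set lie in its norm closure, the convergence holds for the \<open>V n\<close> as well
  (\<open>admissible_ball_sequentially_complete\<close>). The limit selection lies in the slices since the
  conditions that define them are tested by weakly continuous functionals.

  The functionals used along the way come from the Hahn-Banach theorem in its geometric form
  (\<open>separate_convex_from_zero\<close>).
\<close>

section \<open>Linear functionals below sublinear ones\<close>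


definition sublinear :: "('a::real_vector \<Rightarrow> real) \<Rightarrow> bool" where
  "sublinear p \<longleftrightarrow>
     (\<forall>x y. p (x + y) \<le> p x + p y) \<and> (\<forall>c\<ge>0. \<forall>x. p (c *\<^sub>R x) = c * p x)"

lemma sublinear_add: "sublinear p \<Longrightarrow> p (x + y) \<le> p x + p y"
  and sublinear_scale: "sublinear p \<Longrightarrow> c \<ge> 0 \<Longrightarrow> p (c *\<^sub>R x) = c * p x"
  by (auto simp: sublinear_def)

lemma sublinear_zero: "sublinear p \<Longrightarrow> p 0 = 0"
  using sublinear_scale[of p 0 0] by simp

lemma sublinear_lower: "sublinear p \<Longrightarrow> - p (- x) \<le> p x"
  using sublinear_add[of p x "- x"] sublinear_zero[of p] by simp

text \<open>
  Taking \<open>p z\<close> as the infimum of \<open>q (z + t *\<^sub>R k) - t * c\<close> over \<open>t \<ge> 0\<close> and \<open>k \<in> K\<close> lowers \<open>q\<close> in the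
  directions opposite to \<open>K\<close>. Convexity of \<open>K\<close> makes two such competitors add up to a third one,
  which is subadditivity, and \<open>c \<le> q k\<close> keeps the infimum finite. With \<open>K\<close> a singleton this forces
  minimal sublinear functionals to be linear; with \<open>q\<close> the norm it separates \<open>K\<close> from the origin.
\<close>

lemma sublinear_tilt:
  fixes q :: "'a::real_vector \<Rightarrow> real"
  assumes q: "sublinear q" and K: "convex K" "K \<noteq> {}" and c: "\<And>k. k \<in> K \<Longrightarrow> c \<le> q k"
  obtains p where "sublinear p" "\<And>x. p x \<le> q x" "\<And>k. k \<in> K \<Longrightarrow> p (- k) \<le> - c"
proof -
  define I where "I = {0::real..} \<times> K"
  define h where "h z = (\<lambda>(t, k). q (z + t *\<^sub>R k) - t * c)" for z
  define p where "p z = (INF i\<in>I. h z i)" for z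
  have I: "I \<noteq> {}" using K by (auto simp: I_def)
  have low: "- q (- z) \<le> h z i" if "i \<in> I" for z i
  proof -
    obtain t k where i: "i = (t, k)" "t \<ge> 0" "k \<in> K"
      using \<open>i \<in> I\<close> by (auto simp: I_def)
    have "t * c \<le> t * q k" using i c by (simp add: mult_left_mono)
    also have "\<dots> = q ((z + t *\<^sub>R k) + (- z))" using q i by (simp add: sublinear_scale)
    also have "\<dots> \<le> q (z + t *\<^sub>R k) + q (- z)" using q by (rule sublinear_add)
    finally show ?thesis by (simp add: h_def i)
  qed
  have p_le: "p z \<le> q (z + t *\<^sub>R k) - t * c" if "t \<ge> 0" "k \<in> K" for z t k
    unfolding p_def using low that
    by (intro cINF_lower2[of _ _ "(t, k)"] bdd_belowI2) (auto simp: I_def h_def)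
  have p_ge: "m \<le> p z" if "\<And>t k. t \<ge> 0 \<Longrightarrow> k \<in> K \<Longrightarrow> m \<le> q (z + t *\<^sub>R k) - t * c" for z m
    unfolding p_def using that by (intro cINF_greatest I) (auto simp: I_def h_def)
  have pq: "p z \<le> q z" for z
    using K p_le[of 0 _ z] by auto
  have add: "p (x + y) \<le> p x + p y" for x y
  proof -
    have main: "p (x + y) \<le> (q (x + s *\<^sub>R k) - s * c) + (q (y + t *\<^sub>R l) - t * c)"
      if *: "s \<ge> 0" "k \<in> K" "t \<ge> 0" "l \<in> K" for s k t l
    proof (cases "s + t = 0")
      case True
      then have "s = 0" "t = 0" using * by auto
      then show ?thesis using pq[of "x + y"] sublinear_add[OF q, of x y] by simp
    next
      case False
      then have pos: "s + t > 0" using * by simp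
      define m where "m = (s / (s + t)) *\<^sub>R k + (t / (s + t)) *\<^sub>R l"
      have "m \<in> K" unfolding m_def using * pos
        by (intro convexD[OF K(1)]) (auto simp: add_divide_distrib[symmetric])
      moreover have "(s + t) *\<^sub>R m = s *\<^sub>R k + t *\<^sub>R l"
        using pos by (simp add: m_def scaleR_add_right)
      ultimately have "p (x + y) \<le> q ((x + s *\<^sub>R k) + (y + t *\<^sub>R l)) - (s + t) * c"
        using p_le[of "s + t" m "x + y"] pos by (simp add: algebra_simps)
      also have "\<dots> \<le> q (x + s *\<^sub>R k) + q (y + t *\<^sub>R l) - (s + t) * c"
        using sublinear_add[OF q] by simp
      finally show ?thesis by (simp add: algebra_simps)
    qed
    then have "p (x + y) - (q (x + s *\<^sub>R k) - s * c) \<le> p y" if "s \<ge> 0" "k \<in> K" for s k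
      using main[OF that] by (intro p_ge) (simp add: diff_le_eq add.commute)
    then have "p (x + y) - p y \<le> p x"
      by (intro p_ge) (simp add: diff_le_eq add.commute)
    then show ?thesis by simp
  qed
  have p0: "p 0 = 0"
  proof (rule antisym)
    show "p 0 \<le> 0" using pq[of 0] sublinear_zero[OF q] by simp
    show "0 \<le> p 0"
      by (rule p_ge) (use q c in \<open>simp add: sublinear_scale mult_left_mono\<close>)
  qed
  have scale_le: "p (a *\<^sub>R x) \<le> a * p x" if "a > 0" for a x
  proof -
    have "p (a *\<^sub>R x) / a \<le> p x"
    proof (rule p_ge)
      fix t k assume *: "t \<ge> (0::real)" "k \<in> K"
      have "p (a *\<^sub>R x) \<le> q (a *\<^sub>R x + (a * t) *\<^sub>R k) - (a * t) * c"
        using * that by (intro p_le) auto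
      also have "a *\<^sub>R x + (a * t) *\<^sub>R k = a *\<^sub>R (x + t *\<^sub>R k)"
        by (simp add: scaleR_add_right)
      also have "q \<dots> - (a * t) * c = a * (q (x + t *\<^sub>R k) - t * c)"
        using that sublinear_scale[OF q, of a "x + t *\<^sub>R k"] by (simp add: right_diff_distrib mult.assoc)
      finally show "p (a *\<^sub>R x) / a \<le> q (x + t *\<^sub>R k) - t * c"
        using that by (simp add: field_simps)
    qed
    then show ?thesis using that by (simp add: field_simps)
  qed
  have scale: "p (a *\<^sub>R x) = a * p x" if "a \<ge> 0" for a x
  proof (cases "a = 0")
    case False
    then have a: "a > 0" using that by simp
    have "p x \<le> inverse a * p (a *\<^sub>R x)"
      using scale_le[of "inverse a" "a *\<^sub>R x"] a by simp
    then show ?thesis using scale_le[OF a, of x] a by (simp add: field_simps)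
  qed (simp add: p0)
  have "p (- k) \<le> - c" if "k \<in> K" for k
    using p_le[of 1 k "- k"] that sublinear_zero[OF q] by simp
  then show ?thesis
    using that[of p] add scale pq by (auto simp: sublinear_def)
qed

text \<open>
  Hahn-Banach without partially defined functionals: by Zorn's lemma there is a minimal sublinear
  functional below \<open>p\<close>, and minimality forbids every proper tilt, in particular the one that would
  push the value at \<open>- y\<close> below \<open>- f y\<close>.
\<close>

theorem sublinear_dominates_linear:
  fixes p :: "'a::real_vector \<Rightarrow> real"
  assumes p: "sublinear p"
  obtains f where "linear f" "\<And>x. f x \<le> p x"
proof -
  define Q where "Q = {q. sublinear q \<and> (\<forall>x. q x \<le> p x)}"
  define below where "below q q' \<longleftrightarrow> (\<forall>x. q' x \<le> q x)" for q q' :: "'a \<Rightarrow> real"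
  have "\<exists>m\<in>Q. \<forall>q\<in>Q. below m q \<longrightarrow> q = m"
  proof (rule predicate_Zorn)
    show "partial_order_on Q (relation_of below Q)"
      by (rule partial_order_on_relation_ofI) (auto simp: below_def intro: order_trans intro!: ext antisym)
  next
    fix L assume L: "L \<in> Chains (relation_of below Q)"
    have LQ: "q \<in> Q" if "q \<in> L" for q
      using L that by (auto simp: Chains_def relation_of_def)
    have tot: "below q q' \<or> below q' q" if "q \<in> L" "q' \<in> L" for q q'
      using L that by (auto simp: Chains_def relation_of_def)
    show "\<exists>u\<in>Q. \<forall>q\<in>L. below q u"
    proof (cases "L = {}")
      case True
      then show ?thesis using p by (auto simp: Q_def)
    next
      case False
      define u where "u x = (INF q\<in>L. q x)" for x
      have sub: "sublinear q" if "q \<in> L" for q using LQ[OF that] by (simp add: Q_def)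
      have low: "- p (- x) \<le> q x" if "q \<in> L" for q x
        using sublinear_lower[OF sub[OF that], of x] LQ[OF that]
        by (auto simp: Q_def intro: order_trans dest!: spec[of _ "- x"])
      have u_le: "u x \<le> q x" if "q \<in> L" for q x
        unfolding u_def using that low by (intro cINF_lower bdd_belowI2) auto
      have u_ge: "m \<le> u x" if "\<And>q. q \<in> L \<Longrightarrow> m \<le> q x" for m x
        unfolding u_def using that False by (intro cINF_greatest) auto
      have "u (x + y) \<le> u x + u y" for x y
      proof -
        have main: "u (x + y) \<le> q x + q' y" if "q \<in> L" "q' \<in> L" for q q'
        proof -
          have "u (x + y) \<le> q x + q y" "u (x + y) \<le> q' x + q' y"
            using that u_le sub sublinear_add order_trans by blast+
          then show ?thesis using tot[OF that] unfolding below_def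
            by (smt (verit))
        qed
        then have "u (x + y) - q x \<le> u y" if "q \<in> L" for q
          using main[OF that] by (intro u_ge) (simp add: diff_le_eq add.commute)
        then have "u (x + y) - u y \<le> u x"
          by (intro u_ge) (simp add: diff_le_eq add.commute)
        then show ?thesis by simp
      qed
      moreover have "u (a *\<^sub>R x) = a * u x" if a: "a \<ge> 0" for a x
      proof (cases "a = 0")
        case True
        have "u 0 = 0"
          using False sublinear_zero[OF sub] u_le[of _ 0] u_ge[of 0 0] by force
        then show ?thesis using True by simp
      next
        case False
        then have a: "a > 0" using a by simp
        have "u (a *\<^sub>R x) / a \<le> u x"
          using u_le[of _ "a *\<^sub>R x"] sublinear_scale[OF sub, of _ a x] a
          by (intro u_ge) (simp add: field_simps)
        moreover have "a * u x \<le> u (a *\<^sub>R x)"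
        proof (rule u_ge)
          fix q assume q: "q \<in> L"
          have "a * u x \<le> a * q x" using u_le[OF q, of x] a by (simp add: mult_left_mono)
          then show "a * u x \<le> q (a *\<^sub>R x)" using sublinear_scale[OF sub[OF q], of a x] a by simp
        qed
        ultimately show ?thesis using a by (simp add: field_simps)
      qed
      moreover have "u x \<le> p x" for x
      proof -
        obtain q where "q \<in> L" using False by blast
        then have "u x \<le> q x" "q x \<le> p x" using u_le LQ by (auto simp: Q_def)
        then show ?thesis by simp
      qed
      ultimately have "u \<in> Q" by (auto simp: Q_def sublinear_def)
      then show ?thesis using u_le by (auto simp: below_def)
    qed
  qed
  then obtain f where fQ: "f \<in> Q" and max: "\<forall>q\<in>Q. below f q \<longrightarrow> q = f" by blast
  have f: "sublinear f" "\<And>x. f x \<le> p x" using fQ by (auto simp: Q_def)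
  have min: "q = f" if "sublinear q" "\<And>x. q x \<le> f x" for q
  proof -
    have "q x \<le> p x" for x using that(2) f(2) order_trans by blast
    then have "q \<in> Q" "below f q" using that by (auto simp: Q_def below_def)
    then show ?thesis using max by blast
  qed
  \<comment> \<open>The tilt along a single vector does not change a minimal functional.\<close>
  have neg: "f (- y) = - f y" for y
  proof -
    obtain q where q: "sublinear q" "\<And>x. q x \<le> f x" "q (- y) \<le> - f y"
      using sublinear_tilt[OF f(1), of "{y}" "f y"] by auto
    then have "q = f" by (intro min)
    then show ?thesis using q(3) sublinear_lower[OF f(1), of y] by simp
  qed
  have "linear f"
  proof (rule linearI)
    show "f (x + y) = f x + f y" for x y
      using sublinear_add[OF f(1), of x y] sublinear_add[OF f(1), of "- x" "- y"]
        neg[of "x + y"] neg[of x] neg[of y] by simp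
    show "f (c *\<^sub>R x) = c *\<^sub>R f x" for c x
      using sublinear_scale[OF f(1), of c x] sublinear_scale[OF f(1), of "- c" x] neg[of "c *\<^sub>R x"]
      by (cases "c \<ge> 0") auto
  qed
  then show ?thesis using f(2) that by blast
qed

text \<open>
  A linear functional below the tilted norm is bounded by the norm and is at most \<open>- d\<close> on \<open>- K\<close>.
\<close>

theorem separate_convex_from_zero:
  fixes K :: "'a::real_normed_vector set"
  assumes K: "convex K" "K \<noteq> {}" and d: "\<And>k. k \<in> K \<Longrightarrow> d \<le> norm k"
  obtains f :: "'a \<Rightarrow>\<^sub>L real" where "norm f \<le> 1" "\<And>k. k \<in> K \<Longrightarrow> d \<le> blinfun_apply f k"
proof -
  have "sublinear (norm :: 'a \<Rightarrow> real)" by (auto simp: sublinear_def norm_triangle_ineq)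
  from sublinear_tilt[OF this K d] obtain p :: "'a \<Rightarrow> real"
    where p: "sublinear p" "\<And>x. p x \<le> norm x" "\<And>k. k \<in> K \<Longrightarrow> p (- k) \<le> - d" by blast
  obtain f where f: "linear f" "\<And>x. f x \<le> p x"
    using sublinear_dominates_linear[OF p(1)] by blast
  have bound: "\<bar>f x\<bar> \<le> norm x" for x
    using f(2)[of x] p(2)[of x] f(2)[of "- x"] p(2)[of "- x"] linear_neg[OF f(1), of x] by simp
  have bl: "bounded_linear f"
    using f(1) bound by (intro bounded_linear_intro[of _ 1]) (auto simp: linear_add linear_scale)
  show ?thesis
  proof (rule that[of "Blinfun f"])
    show "norm (Blinfun f) \<le> 1"
      by (rule norm_blinfun_bound) (use bound in \<open>auto simp: bounded_linear_Blinfun_apply[OF bl]\<close>)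
    show "d \<le> blinfun_apply (Blinfun f) k" if "k \<in> K" for k
      using f(2)[of "- k"] p(3)[OF that] linear_neg[OF f(1), of k]
      by (simp add: bounded_linear_Blinfun_apply[OF bl])
  qed
qed

section \<open>Weak limits in reflexive spaces\<close>


lemma norming_functional:
  fixes x :: "'a::real_normed_vector"
  obtains f :: "'a \<Rightarrow>\<^sub>L real" where "norm f \<le> 1" "blinfun_apply f x = norm x"
proof -
  obtain f :: "'a \<Rightarrow>\<^sub>L real" where f: "norm f \<le> 1" "norm x \<le> blinfun_apply f x"
    using separate_convex_from_zero[of "{x}" "norm x"]
    by (metis convex_singleton insert_not_empty order_refl singletonD singletonI)
  have "blinfun_apply f x \<le> norm f * norm x"
    using norm_blinfun[of f x] by simp
  also have "\<dots> \<le> norm x" using f(1) by (simp add: mult_left_le_one_le)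
  finally show ?thesis using f that by force
qed

lemma blinfun_le_norm: "norm f \<le> 1 \<Longrightarrow> \<bar>blinfun_apply f x\<bar> \<le> norm x" for f :: "'a::real_normed_vector \<Rightarrow>\<^sub>L real"
  using norm_blinfun[of f x] mult_right_mono[of "norm f" 1 "norm x"] by simp

text \<open>
  The estimate on the representing vector needs a norming functional, since reflexivity only
  supplies the vector itself.
\<close>

lemma reflexive_represents_bidual:
  fixes \<phi> :: "('a::real_normed_vector \<Rightarrow>\<^sub>L real) \<Rightarrow> real"
  assumes refl: "reflexive_space TYPE('a)" and lin: "linear \<phi>" and R: "R \<ge> 0"
    and bound: "\<And>f. \<bar>\<phi> f\<bar> \<le> R * norm f"
  obtains x where "norm x \<le> R" "\<And>f. \<phi> f = blinfun_apply f x"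
proof -
  have "bounded_linear \<phi>"
    using lin bound by (intro bounded_linear_intro[of _ R]) (auto simp: linear_add linear_scale mult.commute)
  then have "blinfun_apply (Blinfun \<phi>) = \<phi>" by (rule bounded_linear_Blinfun_apply)
  then obtain x where x: "\<And>f. \<phi> f = blinfun_apply f x"
    using refl unfolding reflexive_space_def by metis
  obtain f :: "'a \<Rightarrow>\<^sub>L real" where f: "norm f \<le> 1" "blinfun_apply f x = norm x"
    using norming_functional by blast
  have "norm x \<le> R * norm f" using bound[of f] f x by simp
  also have "R * norm f \<le> R * 1" using R f(1) by (intro mult_left_mono) auto
  finally show ?thesis using x that by simp
qed

text \<open>
  The maximizer represents a norming functional for \<open>f\<close> on the dual space.
\<close>

lemma reflexive_norm_attained:
  fixes f :: "'a::real_normed_vector \<Rightarrow>\<^sub>L real"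
  assumes refl: "reflexive_space TYPE('a)"
  obtains z where "norm z \<le> 1" "blinfun_apply f z = norm f"
proof -
  obtain \<phi> :: "('a \<Rightarrow>\<^sub>L real) \<Rightarrow>\<^sub>L real" where \<phi>: "norm \<phi> \<le> 1" "blinfun_apply \<phi> f = norm f"
    using norming_functional by blast
  obtain z where z: "norm z \<le> 1" "\<And>h. blinfun_apply \<phi> h = blinfun_apply h z"
    using reflexive_represents_bidual[OF refl, of "blinfun_apply \<phi>" 1] blinfun_le_norm[OF \<phi>(1)]
      bounded_linear.linear[OF blinfun.bounded_linear_right[of \<phi>]]
    by auto
  then show ?thesis using \<phi>(2) that by metis
qed

text \<open>
  The pointwise limit of the evaluations at \<open>y n\<close> is a bounded functional on the dual space.
\<close>

lemma reflexive_weakly_Cauchy_converges: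
  fixes y :: "nat \<Rightarrow> 'a::real_normed_vector"
  assumes refl: "reflexive_space TYPE('a)" and bound: "\<And>n. norm (y n) \<le> R"
    and Cauchy: "\<And>f :: 'a \<Rightarrow>\<^sub>L real. Cauchy (\<lambda>n. blinfun_apply f (y n))"
  obtains x where "norm x \<le> R" "\<And>f :: 'a \<Rightarrow>\<^sub>L real. (\<lambda>n. blinfun_apply f (y n)) \<longlonglongrightarrow> blinfun_apply f x"
proof -
  define \<phi> where "\<phi> f = lim (\<lambda>n. blinfun_apply f (y n))" for f :: "'a \<Rightarrow>\<^sub>L real"
  have lim: "(\<lambda>n. blinfun_apply f (y n)) \<longlonglongrightarrow> \<phi> f" for f
    unfolding \<phi>_def using Cauchy[of f] by (simp add: Cauchy_convergent convergent_LIMSEQ_iff[symmetric])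
  have "linear \<phi>"
  proof (rule linearI)
    show "\<phi> (f + h) = \<phi> f + \<phi> h" for f h
      using LIMSEQ_unique[OF lim[of "f + h"]] tendsto_add[OF lim[of f] lim[of h]]
      by (simp add: blinfun.add_left)
    show "\<phi> (c *\<^sub>R f) = c *\<^sub>R \<phi> f" for c f
      using LIMSEQ_unique[OF lim[of "c *\<^sub>R f"]] tendsto_scaleR[OF tendsto_const lim[of f], of c]
      by (simp add: blinfun.scaleR_left)
  qed
  moreover have "\<bar>\<phi> f\<bar> \<le> R * norm f" for f
  proof (rule LIMSEQ_le_const2[OF tendsto_rabs[OF lim]])
    have "\<bar>blinfun_apply f (y n)\<bar> \<le> R * norm f" for n
      using norm_blinfun[of f "y n"] mult_left_mono[OF bound[of n], of "norm f"]
      by (simp add: mult.commute)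
    then show "\<exists>N. \<forall>n\<ge>N. \<bar>blinfun_apply f (y n)\<bar> \<le> R * norm f" by blast
  qed
  ultimately obtain x where "norm x \<le> R" "\<And>f. \<phi> f = blinfun_apply f x"
    using reflexive_represents_bidual[OF refl, of \<phi> R] order_trans[OF norm_ge_zero bound] by blast
  then show ?thesis using that lim by metis
qed

text \<open>
  Mazur's lemma in the form used below: a convex set at positive distance from \<open>x\<close> is strictly
  separated from \<open>x\<close> by a functional, which the weak convergence contradicts.
\<close>

lemma weak_limit_of_convex_near:
  fixes K :: "'a::real_normed_vector set"
  assumes K: "convex K" and y: "\<And>n. n \<ge> (N::nat) \<Longrightarrow> y n \<in> K" and e: "e > 0"
    and weak: "\<And>f :: 'a \<Rightarrow>\<^sub>L real. (\<lambda>n. blinfun_apply f (y n)) \<longlonglongrightarrow> blinfun_apply f x"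
  shows "\<exists>k\<in>K. dist x k < e"
proof (rule ccontr)
  assume "\<not> ?thesis"
  then have far: "e \<le> norm k" if "k \<in> (\<lambda>k. k - x) ` K" for k
    using that by (auto simp: dist_norm norm_minus_commute not_less)
  have "convex ((\<lambda>k. k - x) ` K)" by (simp add: K convex_translation_subtract)
  moreover have "(\<lambda>k. k - x) ` K \<noteq> {}" using y by blast
  ultimately obtain f :: "'a \<Rightarrow>\<^sub>L real"
    where "norm f \<le> 1" and f: "\<And>k. k \<in> (\<lambda>k. k - x) ` K \<Longrightarrow> e \<le> blinfun_apply f k"
    using separate_convex_from_zero[OF _ _ far] by metis
  have "e \<le> blinfun_apply f (y n) - blinfun_apply f x" if "n \<ge> N" for n
    using f[of "y n - x"] y[OF that] by (simp add: blinfun.diff_right)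
  then have "e \<le> blinfun_apply f x - blinfun_apply f x"
    by (intro LIMSEQ_le_const[OF tendsto_diff[OF weak tendsto_const]]) blast
  then show False using e by simp
qed

section \<open>Slices of a ball under perturbation of the functional\<close>


text \<open>
  The exact distance matters: it is small when \<open>f\<close> has only little to gain from \<open>y\<close> to the level \<open>a\<close>
  compared with its total gain from \<open>y\<close> to \<open>z\<close>.
\<close>

lemma segment_hits_level:
  fixes f :: "'a::real_normed_vector \<Rightarrow>\<^sub>L real"
  assumes y: "norm y \<le> r" and z: "norm z \<le> r" and a: "blinfun_apply f y \<le> a" "a \<le> blinfun_apply f z"
    and less: "blinfun_apply f y < blinfun_apply f z"
  obtains w where "norm w \<le> r" "blinfun_apply f w = a"
    "dist w y = (a - blinfun_apply f y) / (blinfun_apply f z - blinfun_apply f y) * dist z y"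
proof -
  define t where "t = (a - blinfun_apply f y) / (blinfun_apply f z - blinfun_apply f y)"
  define w where "w = (1 - t) *\<^sub>R y + t *\<^sub>R z"
  have t: "0 \<le> t" "t \<le> 1" using a less by (auto simp: t_def divide_simps)
  have "w \<in> cball 0 r"
    unfolding w_def using t y z by (intro convexD[OF convex_cball]) auto
  moreover have "w - y = t *\<^sub>R (z - y)" by (simp add: w_def algebra_simps)
  then have "dist w y = t * dist z y" using t by (simp add: dist_norm)
  moreover have "blinfun_apply f w = a"
  proof -
    have "w = y + t *\<^sub>R (z - y)" by (simp add: w_def algebra_simps)
    then have "blinfun_apply f w = blinfun_apply f y + t * (blinfun_apply f z - blinfun_apply f y)"
      by (simp only: blinfun.add_right blinfun.scaleR_right blinfun.diff_right real_scaleR_def)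
    then show ?thesis using less by (simp add: t_def)
  qed
  ultimately show ?thesis using that by (simp add: t_def)
qed

lemma locally_uniformly_convex_sphere:
  fixes y :: "'a::real_normed_vector"
  assumes luc: "locally_uniformly_convex TYPE('a)" and r: "r > 0" and y: "norm y = r" and e: "e > 0"
  obtains d where "d > 0" "\<And>z. norm z = r \<Longrightarrow> e \<le> dist y z \<Longrightarrow> norm (y + z) \<le> 2 * r * (1 - d)"
proof -
  have unit: "norm (y /\<^sub>R r) = 1" and pos: "e / r > 0" using r y e by auto
  obtain d where d: "d > 0"
    "\<And>u. norm u = 1 \<Longrightarrow> e / r \<le> norm (y /\<^sub>R r - u) \<Longrightarrow> norm (y /\<^sub>R r + u) \<le> 2 * (1 - d)"
    using luc[unfolded locally_uniformly_convex_def, rule_format, OF pos unit] by blast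
  have "norm (y + z) \<le> 2 * r * (1 - d)" if "norm z = r" "e \<le> dist y z" for z
  proof -
    have "norm (y /\<^sub>R r - z /\<^sub>R r) = dist y z / r"
      using r by (simp only: scaleR_diff_right[symmetric] norm_scaleR dist_norm) (simp add: divide_inverse)
    then have "e / r \<le> norm (y /\<^sub>R r - z /\<^sub>R r)"
      using that(2) r by (simp add: divide_right_mono)
    then have "norm (y /\<^sub>R r + z /\<^sub>R r) \<le> 2 * (1 - d)"
      using that(1) r by (intro d) auto
    moreover have "norm (y /\<^sub>R r + z /\<^sub>R r) = norm (y + z) / r"
      using r by (simp only: scaleR_add_right[symmetric] norm_scaleR) (simp add: divide_inverse)
    ultimately have "norm (y + z) / r \<le> 2 * (1 - d)" by (simp only:)
    then show ?thesis using r by (simp only: pos_divide_le_eq) (simp add: mult_ac)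
  qed
  then show ?thesis using d(1) that by blast
qed

text \<open>
  In each case a point of norm at most \<open>r\<close> is produced at which \<open>f\<close> is at least \<open>a\<close>, and the slice is hit on
  the segment from \<open>y0\<close> to it. If \<open>f0\<close> exceeds \<open>a0\<close> somewhere on the ball, one such point serves all
  nearby \<open>f\<close>. Otherwise \<open>y0\<close> maximizes \<open>f0\<close> on the ball and the target is a maximizer of \<open>f\<close>, which may
  be far from \<open>y0\<close> because \<open>f\<close> is close to \<open>f0\<close> at finitely many points only. Closeness at finitely
  many points is all that weak continuity of an operator can provide.
\<close>

lemma hyperplane_ball_lower_stable_above:
  fixes f0 :: "'a::real_normed_vector \<Rightarrow>\<^sub>L real"
  assumes attained: "\<And>f :: 'a \<Rightarrow>\<^sub>L real. \<exists>z. norm z \<le> 1 \<and> blinfun_apply f z = norm f"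
    and luc: "locally_uniformly_convex TYPE('a)"
    and r: "r > 0" and f0: "f0 \<noteq> 0" and y0: "norm y0 \<le> r" "blinfun_apply f0 y0 = a0" and e: "e > 0"
  shows "\<exists>\<eta>>0. \<exists>z0. \<forall>f a. \<bar>a\<bar> \<le> r * norm f \<longrightarrow> \<bar>blinfun_apply f y0 - a0\<bar> < \<eta> \<longrightarrow>
    \<bar>blinfun_apply f z0 - blinfun_apply f0 z0\<bar> < \<eta> \<longrightarrow> \<bar>a - a0\<bar> < \<eta> \<longrightarrow> blinfun_apply f y0 \<le> a \<longrightarrow>
    (\<exists>y. norm y \<le> r \<and> blinfun_apply f y = a \<and> dist y y0 < e)"
proof -
  have maximizer: "\<exists>z. norm z \<le> r \<and> blinfun_apply f z = r * norm f" for f :: "'a \<Rightarrow>\<^sub>L real"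
  proof -
    obtain z where "norm z \<le> 1" "blinfun_apply f z = norm f" using attained by blast
    then show ?thesis using r by (intro exI[of _ "r *\<^sub>R z"]) (auto simp: blinfun.scaleR_right mult_left_le)
  qed
  have close: "\<exists>y. norm y \<le> r \<and> blinfun_apply f y = a \<and> dist y y0 < e"
    if fa: "blinfun_apply f y0 \<le> a" "a \<le> blinfun_apply f z" "blinfun_apply f y0 < blinfun_apply f z"
      and z: "norm z \<le> r" and small: "(a - blinfun_apply f y0) * (2 * r) < e * (blinfun_apply f z - blinfun_apply f y0)"
    for f :: "'a \<Rightarrow>\<^sub>L real" and a z
  proof -
    obtain w where w: "norm w \<le> r" "blinfun_apply f w = a"
      "dist w y0 = (a - blinfun_apply f y0) / (blinfun_apply f z - blinfun_apply f y0) * dist z y0"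
      using segment_hits_level[OF y0(1) z fa] by blast
    have "dist z y0 \<le> 2 * r"
      using norm_triangle_ineq4[of z y0] z y0(1) by (simp add: dist_norm)
    then have "dist w y0 \<le> (a - blinfun_apply f y0) / (blinfun_apply f z - blinfun_apply f y0) * (2 * r)"
      unfolding w(3) using fa by (intro mult_left_mono) auto
    also have "\<dots> < e" using small fa by (simp add: field_simps)
    finally show ?thesis using w by blast
  qed
  show ?thesis
  proof (cases "\<exists>z. norm z \<le> r \<and> a0 < blinfun_apply f0 z")
    case True
    then obtain z0 where z0: "norm z0 \<le> r" "a0 < blinfun_apply f0 z0" by blast
    define d where "d = blinfun_apply f0 z0 - a0"
    have d: "d > 0" using z0 by (simp add: d_def)
    \<comment> \<open>The first bound keeps half of the gain \<open>d\<close> of \<open>f0\<close> on the segment, the second one makes the slice close.\<close>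
    define \<eta> where "\<eta> = min (d / 8) (d * e / (16 * r))"
    have \<eta>: "\<eta> > 0" "\<eta> \<le> d / 8" "\<eta> * (16 * r) \<le> d * e"
    proof -
      show "\<eta> > 0" "\<eta> \<le> d / 8" using d e r by (simp_all add: \<eta>_def)
      have "\<eta> \<le> d * e / (16 * r)" by (simp add: \<eta>_def)
      then show "\<eta> * (16 * r) \<le> d * e" using r by (simp add: field_simps)
    qed
    have "\<exists>y. norm y \<le> r \<and> blinfun_apply f y = a \<and> dist y y0 < e"
      if *: "\<bar>blinfun_apply f y0 - a0\<bar> < \<eta>" "\<bar>blinfun_apply f z0 - blinfun_apply f0 z0\<bar> < \<eta>"
        "\<bar>a - a0\<bar> < \<eta>" "blinfun_apply f y0 \<le> a" for f :: "'a \<Rightarrow>\<^sub>L real" and a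
    proof (rule close[OF *(4) _ _ z0(1)])
      have gap: "blinfun_apply f z0 - blinfun_apply f y0 > d / 2"
        using * \<eta> d by (simp add: d_def abs_less_iff)
      show "a \<le> blinfun_apply f z0" "blinfun_apply f y0 < blinfun_apply f z0"
        using * \<eta> d by (simp_all add: d_def abs_less_iff)
      have "(a - blinfun_apply f y0) * (2 * r) \<le> (2 * \<eta>) * (2 * r)"
        using * r by (intro mult_right_mono) auto
      also have "\<dots> < e * (d / 2)" using \<eta>(3) mult_pos_pos[OF \<eta>(1) r] by (simp add: algebra_simps)
      also have "\<dots> \<le> e * (blinfun_apply f z0 - blinfun_apply f y0)"
        using gap e by (intro mult_left_mono) auto
      finally show "(a - blinfun_apply f y0) * (2 * r) < e * (blinfun_apply f z0 - blinfun_apply f y0)" .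
    qed
    then show ?thesis using \<eta>(1) by blast
  next
    case False
    obtain z0 where "norm z0 \<le> r" "blinfun_apply f0 z0 = r * norm f0" using maximizer by blast
    then have "r * norm f0 \<le> a0" using False by (metis not_le)
    moreover have "r * norm f0 > 0" using r f0 by simp
    ultimately have a0: "a0 > 0" "a0 \<ge> r * norm f0" by auto
    have "a0 \<le> norm f0 * norm y0" using norm_blinfun[of f0 y0] y0 by simp
    then have "r * norm f0 \<le> norm y0 * norm f0" using a0 by (simp add: mult.commute)
    then have ny0: "norm y0 = r" using y0 f0 by simp
    obtain d where d: "d > 0" "\<And>z. norm z = r \<Longrightarrow> e \<le> dist y0 z \<Longrightarrow> norm (y0 + z) \<le> 2 * r * (1 - d)"
      using locally_uniformly_convex_sphere[OF luc r ny0 e] by blast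
    \<comment> \<open>The first bound keeps \<open>f y0\<close> above \<open>a0 / 2\<close>, so that the gain to a far maximizer is at least \<open>d * a0\<close>.\<close>
    define \<eta> where "\<eta> = min (a0 / 2) (d * a0 * e / (8 * r))"
    have \<eta>: "\<eta> > 0" "\<eta> \<le> a0 / 2" "\<eta> * (8 * r) \<le> d * a0 * e"
    proof -
      show "\<eta> > 0" "\<eta> \<le> a0 / 2" using d e r a0 by (simp_all add: \<eta>_def)
      have "\<eta> \<le> d * a0 * e / (8 * r)" by (simp add: \<eta>_def)
      then show "\<eta> * (8 * r) \<le> d * a0 * e" using r by (simp add: field_simps)
    qed
    have "\<exists>y. norm y \<le> r \<and> blinfun_apply f y = a \<and> dist y y0 < e"
      if *: "\<bar>a\<bar> \<le> r * norm f" "\<bar>blinfun_apply f y0 - a0\<bar> < \<eta>" "\<bar>a - a0\<bar> < \<eta>" "blinfun_apply f y0 \<le> a"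
      for f :: "'a \<Rightarrow>\<^sub>L real" and a
    proof (cases "a = blinfun_apply f y0")
      case True
      then show ?thesis using y0 e by (intro exI[of _ y0]) auto
    next
      case False
      obtain z where z: "norm z \<le> r" "blinfun_apply f z = r * norm f" using maximizer by blast
      have fy0: "blinfun_apply f y0 \<ge> a0 / 2" using * \<eta> by (simp add: abs_less_iff)
      have az: "a \<le> blinfun_apply f z" using * z by simp
      have less: "blinfun_apply f y0 < blinfun_apply f z" using * False az by simp
      have fpos: "norm f > 0" using fy0 a0 by auto
      have "r * norm f \<le> norm f * norm z" using norm_blinfun[of f z] z by simp
      then have nz: "norm z = r" using z fpos by (simp add: mult.commute)
      show ?thesis
      proof (cases "dist y0 z < e")
        case True
        obtain w where w: "norm w \<le> r" "blinfun_apply f w = a"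
          "dist w y0 = (a - blinfun_apply f y0) / (blinfun_apply f z - blinfun_apply f y0) * dist z y0"
          using segment_hits_level[OF y0(1) z(1) *(4) az less] by blast
        have "dist w y0 \<le> 1 * dist z y0"
          unfolding w(3) using *(4) az less by (intro mult_right_mono) auto
        then show ?thesis using w True by (auto simp: dist_commute)
      next
        case far: False
        have "blinfun_apply f y0 + r * norm f = blinfun_apply f (y0 + z)"
          using z by (simp add: blinfun.add_right)
        also have "\<dots> \<le> norm f * norm (y0 + z)" using norm_blinfun[of f "y0 + z"] by simp
        also have "\<dots> \<le> norm f * (2 * r * (1 - d))"
          using d(2)[OF nz] far by (intro mult_left_mono) auto
        finally have "2 * d * (r * norm f) \<le> r * norm f - blinfun_apply f y0"
          by (simp add: algebra_simps)
        moreover have "2 * d * (a0 / 2) \<le> 2 * d * (r * norm f)"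
          using fy0 less z d(1) by (intro mult_left_mono) auto
        ultimately have gap: "d * a0 \<le> blinfun_apply f z - blinfun_apply f y0"
          using z by simp
        have "(a - blinfun_apply f y0) * (2 * r) \<le> (2 * \<eta>) * (2 * r)"
          using * r by (intro mult_right_mono) auto
        also have "\<dots> < e * (d * a0)" using \<eta>(3) mult_pos_pos[OF \<eta>(1) r] by (simp add: algebra_simps)
        also have "\<dots> \<le> e * (blinfun_apply f z - blinfun_apply f y0)"
          using gap e by (intro mult_left_mono) auto
        finally show ?thesis by (rule close[OF *(4) az less z(1)])
      qed
    qed
    then show ?thesis using \<eta>(1) by blast
  qed
qed

text \<open>
  The case in which \<open>f\<close> is too large at \<open>y0\<close> is the other one for \<open>- f\<close> and \<open>- a\<close>.
\<close>

lemma hyperplane_ball_lower_stable: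
  fixes f0 :: "'a::real_normed_vector \<Rightarrow>\<^sub>L real"
  assumes attained: "\<And>f :: 'a \<Rightarrow>\<^sub>L real. \<exists>z. norm z \<le> 1 \<and> blinfun_apply f z = norm f"
    and luc: "locally_uniformly_convex TYPE('a)"
    and r: "r > 0" and f0: "f0 \<noteq> 0" and y0: "norm y0 \<le> r" "blinfun_apply f0 y0 = a0" and e: "e > 0"
  shows "\<exists>\<eta>>0. \<exists>z1 z2. \<forall>f a. \<bar>a\<bar> \<le> r * norm f \<longrightarrow> \<bar>blinfun_apply f y0 - a0\<bar> < \<eta> \<longrightarrow>
    \<bar>blinfun_apply f z1 - blinfun_apply f0 z1\<bar> < \<eta> \<longrightarrow> \<bar>blinfun_apply f z2 - blinfun_apply f0 z2\<bar> < \<eta> \<longrightarrow>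
    \<bar>a - a0\<bar> < \<eta> \<longrightarrow> (\<exists>y. norm y \<le> r \<and> blinfun_apply f y = a \<and> dist y y0 < e)"
proof -
  obtain \<eta>1 z1 where 1: "\<eta>1 > 0"
    "\<And>f a. \<bar>a\<bar> \<le> r * norm f \<Longrightarrow> \<bar>blinfun_apply f y0 - a0\<bar> < \<eta>1 \<Longrightarrow>
      \<bar>blinfun_apply f z1 - blinfun_apply f0 z1\<bar> < \<eta>1 \<Longrightarrow> \<bar>a - a0\<bar> < \<eta>1 \<Longrightarrow> blinfun_apply f y0 \<le> a \<Longrightarrow>
      \<exists>y. norm y \<le> r \<and> blinfun_apply f y = a \<and> dist y y0 < e"
    using hyperplane_ball_lower_stable_above[OF attained luc r f0 y0 e] by blast
  have "- f0 \<noteq> 0" "blinfun_apply (- f0) y0 = - a0" using f0 y0 by (auto simp: blinfun.minus_left)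
  from hyperplane_ball_lower_stable_above[OF attained luc r this(1) y0(1) this(2) e]
  obtain \<eta>2 z2 where 2: "\<eta>2 > 0"
    "\<And>f a. \<bar>a\<bar> \<le> r * norm f \<Longrightarrow> \<bar>blinfun_apply f y0 - (- a0)\<bar> < \<eta>2 \<Longrightarrow>
      \<bar>blinfun_apply f z2 - blinfun_apply (- f0) z2\<bar> < \<eta>2 \<Longrightarrow> \<bar>a - (- a0)\<bar> < \<eta>2 \<Longrightarrow> blinfun_apply f y0 \<le> a \<Longrightarrow>
      \<exists>y. norm y \<le> r \<and> blinfun_apply f y = a \<and> dist y y0 < e"
    by blast
  have "\<exists>y. norm y \<le> r \<and> blinfun_apply f y = a \<and> dist y y0 < e"
    if *: "\<bar>a\<bar> \<le> r * norm f" "\<bar>blinfun_apply f y0 - a0\<bar> < min \<eta>1 \<eta>2"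
      "\<bar>blinfun_apply f z1 - blinfun_apply f0 z1\<bar> < min \<eta>1 \<eta>2"
      "\<bar>blinfun_apply f z2 - blinfun_apply f0 z2\<bar> < min \<eta>1 \<eta>2" "\<bar>a - a0\<bar> < min \<eta>1 \<eta>2" for f a
  proof (cases "blinfun_apply f y0 \<le> a")
    case True
    then show ?thesis using * by (intro 1) auto
  next
    case False
    have "\<exists>y. norm y \<le> r \<and> blinfun_apply (- f) y = - a \<and> dist y y0 < e"
      using * False by (intro 2) (auto simp: blinfun.minus_left abs_minus_commute)
    then show ?thesis by (auto simp: blinfun.minus_left)
  qed
  then show ?thesis using 1(1) 2(1)
    by (intro exI[of _ "min \<eta>1 \<eta>2"] conjI exI[of _ z1] exI[of _ z2]) auto
qed

section \<open>Partitions of unity on paracompact spaces\<close>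


lemma paracompact_refine:
  assumes X: "paracompact_space X" and \<U>: "\<And>U. U \<in> \<U> \<Longrightarrow> openin X U" "\<Union>\<U> = topspace X"
  obtains \<V> where "\<And>V. V \<in> \<V> \<Longrightarrow> openin X V" "\<Union>\<V> = topspace X"
    "\<And>V. V \<in> \<V> \<Longrightarrow> \<exists>U\<in>\<U>. V \<subseteq> U" "locally_finite_in X \<V>"
proof -
  have "\<exists>\<V>. (\<forall>V\<in>\<V>. openin X V) \<and> \<Union>\<V> = topspace X \<and>
      (\<forall>V\<in>\<V>. \<exists>U\<in>\<U>. V \<subseteq> U) \<and> locally_finite_in X \<V>"
    using X \<U> by (simp add: paracompact_space_def)
  then obtain \<V> where V: "\<forall>V\<in>\<V>. openin X V" "\<Union>\<V> = topspace X"
      "\<forall>V\<in>\<V>. \<exists>U\<in>\<U>. V \<subseteq> U" "locally_finite_in X \<V>"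
    by (elim exE conjE)
  show ?thesis
    by (rule that[of \<V>]) (use V in auto)
qed

text \<open>
  This turns separation from points into separation from closed sets. It is applied twice, first to
  get regularity from the Hausdorff property and then normality from regularity.
\<close>

lemma paracompact_separate_closed:
  assumes X: "paracompact_space X" and S: "closedin X S"
    and sep: "\<And>y. y \<in> S \<Longrightarrow> \<exists>U. openin X U \<and> y \<in> U \<and> disjnt T (X closure_of U)"
  shows "\<exists>W. openin X W \<and> S \<subseteq> W \<and> disjnt T (X closure_of W)"
proof -
  obtain U where U: "\<And>y. y \<in> S \<Longrightarrow> openin X (U y) \<and> y \<in> U y \<and> disjnt T (X closure_of U y)"
    using sep by metis
  define \<U> where "\<U> = insert (topspace X - S) (U ` S)"
  have open_\<U>: "openin X G" if "G \<in> \<U>" for G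
    using that U S by (auto simp: \<U>_def)
  have cover: "\<Union>\<U> = topspace X"
  proof
    show "\<Union>\<U> \<subseteq> topspace X"
    proof (rule Union_least)
      show "G \<subseteq> topspace X" if "G \<in> \<U>" for G
        using that U[THEN conjunct1, THEN openin_subset] by (auto simp: \<U>_def)
    qed
    have "S \<subseteq> \<Union>(U ` S)" using U by blast
    then show "topspace X \<subseteq> \<Union>\<U>" by (auto simp: \<U>_def)
  qed
  obtain \<V> where \<V>: "\<And>V. V \<in> \<V> \<Longrightarrow> openin X V" "\<Union>\<V> = topspace X"
    "\<And>V. V \<in> \<V> \<Longrightarrow> \<exists>G\<in>\<U>. V \<subseteq> G" "locally_finite_in X \<V>"
    using paracompact_refine[OF X open_\<U> cover] by blast
  define \<W> where "\<W> = {V \<in> \<V>. V \<inter> S \<noteq> {}}"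
  have "locally_finite_in X \<W>"
    using \<V>(4) by (rule locally_finite_in_subset) (auto simp: \<W>_def)
  then have clo: "X closure_of (\<Union>\<W>) = (\<Union>V\<in>\<W>. X closure_of V)"
    by (rule closure_of_locally_finite_Union)
  have "disjnt T (X closure_of V)" if "V \<in> \<W>" for V
  proof -
    have V: "V \<in> \<V>" "V \<inter> S \<noteq> {}" using that by (auto simp: \<W>_def)
    obtain G where "G \<in> \<U>" "V \<subseteq> G" using \<V>(3)[OF V(1)] by blast
    then obtain y where y: "y \<in> S" "V \<subseteq> U y" using V(2) by (auto simp: \<U>_def)
    show ?thesis
      using U[OF y(1)] closure_of_mono[OF y(2), of X] by (meson disjnt_subset2)
  qed
  then have "disjnt T (X closure_of (\<Union>\<W>))" by (auto simp: clo disjnt_def)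
  moreover have "openin X (\<Union>\<W>)" using \<V>(1) by (auto simp: \<W>_def)
  moreover have "S \<subseteq> \<Union>\<W>"
  proof -
    have "S \<subseteq> \<Union>\<V>" using \<V>(2) closedin_subset[OF S] by simp
    then show ?thesis unfolding \<W>_def by blast
  qed
  ultimately show ?thesis by blast
qed

lemma paracompact_imp_normal_space:
  assumes X: "paracompact_space X"
  shows "normal_space X"
proof -
  have H: "Hausdorff_space X" using X by (simp add: paracompact_space_def)
  have point: "\<exists>U. openin X U \<and> x \<in> U \<and> disjnt S (X closure_of U)"
    if S: "closedin X S" and x: "x \<in> topspace X - S" for S x
  proof -
    have "\<exists>U. openin X U \<and> y \<in> U \<and> disjnt {x} (X closure_of U)" if y: "y \<in> S" for y
    proof -
      have "y \<in> topspace X" "y \<noteq> x" using y x closedin_subset[OF S] by auto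
      then obtain U V where UV: "openin X U" "openin X V" "x \<in> U" "y \<in> V" "disjnt U V"
        using H x unfolding Hausdorff_space_def by blast
      then have "U \<inter> X closure_of V = {}"
        using openin_Int_closure_of_eq_empty[OF UV(1), of V] by (simp add: disjnt_def)
      then show ?thesis using UV by (auto simp: disjnt_def)
    qed
    from paracompact_separate_closed[OF X S this]
    obtain W where W: "openin X W" "S \<subseteq> W" "x \<notin> X closure_of W" by (auto simp: disjnt_def)
    let ?U = "topspace X - X closure_of W"
    have "openin X ?U" by auto
    moreover have "W \<inter> X closure_of ?U = {}"
      using openin_Int_closure_of_eq_empty[OF W(1), of ?U] closure_of_subset[OF openin_subset[OF W(1)]]
      by auto
    ultimately show ?thesis using W x by (auto simp: disjnt_def)
  qed
  show ?thesis
    unfolding normal_space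
  proof (intro allI impI)
    fix S T assume ST: "closedin X S \<and> closedin X T \<and> disjnt S T"
    have "\<exists>U. openin X U \<and> y \<in> U \<and> disjnt T (X closure_of U)" if "y \<in> S" for y
      using ST that closedin_subset[of X S] by (intro point) (auto simp: disjnt_def)
    then show "\<exists>U. openin X U \<and> S \<subseteq> U \<and> disjnt T (X closure_of U)"
      using paracompact_separate_closed[OF X] ST by blast
  qed
qed

lemma continuous_map_finite_sum:
  fixes T :: "'c::comm_monoid_add topology"
  assumes add: "continuous_map (prod_topology T T) T (\<lambda>(a, b). a + b)" and zero: "0 \<in> topspace T"
    and "finite I" "\<And>i. i \<in> I \<Longrightarrow> continuous_map X T (f i)"
  shows "continuous_map X T (\<lambda>x. \<Sum>i\<in>I. f i x)"
  using assms(3,4)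
proof (induction I)
  case empty
  then show ?case using zero by simp
next
  case (insert i I)
  then have "continuous_map X (prod_topology T T) (\<lambda>x. (f i x, \<Sum>i\<in>I. f i x))"
    by (simp add: continuous_map_pairwise o_def)
  from continuous_map_compose[OF this add] insert.hyps show ?case by (simp add: o_def)
qed

text \<open>
  Stated for an arbitrary topology with continuous addition, so that it covers both the real-valued
  normalizing sum of a partition of unity and vector-valued combinations in a topology other than
  that of the norm.
\<close>

lemma continuous_map_locally_finite_sum:
  fixes T :: "'c::comm_monoid_add topology"
  assumes add: "continuous_map (prod_topology T T) T (\<lambda>(a, b). a + b)" and zero: "0 \<in> topspace T"
    and lf: "locally_finite_in X \<V>"
    and cont: "\<And>V. V \<in> \<V> \<Longrightarrow> continuous_map X T (f V)"
    and supp: "\<And>V x. V \<in> \<V> \<Longrightarrow> x \<in> topspace X - V \<Longrightarrow> f V x = 0"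
  shows "continuous_map X T (\<lambda>x. \<Sum>V | V \<in> \<V> \<and> x \<in> V. f V x)"
proof -
  define near where "near x N \<longleftrightarrow> openin X N \<and> x \<in> N \<and> finite {V \<in> \<V>. V \<inter> N \<noteq> {}}" for x N
  have "\<forall>x\<in>topspace X. \<exists>N. near x N"
    using lf by (simp add: locally_finite_in_def near_def)
  then obtain N where "\<forall>x\<in>topspace X. near x (N x)"
    by metis
  then have N: "openin X (N x) \<and> x \<in> N x \<and> finite {V \<in> \<V>. V \<inter> N x \<noteq> {}}"
    if "x \<in> topspace X" for x
    using that by (simp add: near_def)
  define F where "F i = {V \<in> \<V>. V \<inter> N i \<noteq> {}}" for i
  have eq: "(\<Sum>V | V \<in> \<V> \<and> x \<in> V. f V x) = (\<Sum>V\<in>F i. f V x)"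
    if "i \<in> topspace X" "x \<in> N i" for i x
  proof (rule sum.mono_neutral_left)
    show "finite (F i)" using N[OF that(1)] by (simp add: F_def)
    show "{V. V \<in> \<V> \<and> x \<in> V} \<subseteq> F i" using that by (auto simp: F_def)
    have "x \<in> topspace X" using that(2) N[OF that(1)] openin_subset by blast
    then show "\<forall>V\<in>F i - {V. V \<in> \<V> \<and> x \<in> V}. f V x = 0"
      using supp by (simp add: F_def)
  qed
  show ?thesis
  proof (rule pasting_lemma[where I = "topspace X" and T = N and f = "\<lambda>i x. \<Sum>V\<in>F i. f V x"])
    fix i assume i: "i \<in> topspace X"
    then show "openin X (N i)" using N by simp
    show "continuous_map (subtopology X (N i)) T (\<lambda>x. \<Sum>V\<in>F i. f V x)"
      using N[OF i] cont
      by (intro continuous_map_from_subtopology continuous_map_finite_sum[OF add zero]) (auto simp: F_def)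
  next
    fix i j x assume "i \<in> topspace X" "j \<in> topspace X" "x \<in> topspace X \<inter> N i \<inter> N j"
    then show "(\<Sum>V\<in>F i. f V x) = (\<Sum>V\<in>F j. f V x)"
      using eq[of i x] eq[of j x] by simp
  next
    fix x assume x: "x \<in> topspace X"
    with N[OF x] eq[OF x, of x]
    show "\<exists>i. i \<in> topspace X \<and> x \<in> N i \<and> (\<Sum>V | V \<in> \<V> \<and> x \<in> V. f V x) = (\<Sum>V\<in>F i. f V x)"
      by blast
  qed
qed

text \<open>
  Two successive refinements replace the shrinking lemma: the closures of the finer sets that are
  assigned to \<open>V\<close> have a closed union inside \<open>V\<close>, so Urysohn's lemma gives a bump function supported in
  \<open>V\<close>, and these closed unions still cover the space. Functions that vanish outside the members of
  a locally finite family have a continuous sum.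
\<close>

theorem paracompact_partition_of_unity:
  assumes X: "paracompact_space X" and \<U>: "\<And>U. U \<in> \<U> \<Longrightarrow> openin X U" "\<Union>\<U> = topspace X"
  obtains \<V> and \<phi> :: "'a set \<Rightarrow> 'a \<Rightarrow> real" where
    "locally_finite_in X \<V>" "\<And>V. V \<in> \<V> \<Longrightarrow> \<exists>U\<in>\<U>. V \<subseteq> U"
    "\<And>V. V \<in> \<V> \<Longrightarrow> continuous_map X euclideanreal (\<phi> V)"
    "\<And>V x. V \<in> \<V> \<Longrightarrow> x \<in> topspace X \<Longrightarrow> 0 \<le> \<phi> V x"
    "\<And>V x. V \<in> \<V> \<Longrightarrow> x \<in> topspace X - V \<Longrightarrow> \<phi> V x = 0"
    "\<And>x. x \<in> topspace X \<Longrightarrow> (\<Sum>V | V \<in> \<V> \<and> x \<in> V. \<phi> V x) = 1"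
proof -
  have norm: "normal_space X" using X by (rule paracompact_imp_normal_space)
  have H: "Hausdorff_space X" using X by (simp add: paracompact_space_def)
  obtain \<V> where \<V>: "\<And>V. V \<in> \<V> \<Longrightarrow> openin X V" "\<Union>\<V> = topspace X"
    "\<And>V. V \<in> \<V> \<Longrightarrow> \<exists>U\<in>\<U>. V \<subseteq> U" "locally_finite_in X \<V>"
    using paracompact_refine[OF X \<U>] by blast
  define \<S> where "\<S> = {S. openin X S \<and> (\<exists>V\<in>\<V>. X closure_of S \<subseteq> V)}"
  have \<S>_open: "openin X S" if "S \<in> \<S>" for S
    using that by (simp add: \<S>_def)
  have "\<Union>\<S> = topspace X"
  proof
    show "topspace X \<subseteq> \<Union>\<S>"
    proof
      fix x assume x: "x \<in> topspace X"
      then obtain V where V: "V \<in> \<V>" "x \<in> V" using \<V>(2) by blast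
      have "closedin X {x}" using H x by (simp add: closedin_Hausdorff_singleton)
      then obtain S where "openin X S" "{x} \<subseteq> S" "X closure_of S \<subseteq> V"
        using norm V \<V>(1) unfolding normal_space_alt by (metis empty_subsetI insert_subset)
      then show "x \<in> \<Union>\<S>" using V by (auto simp: \<S>_def)
    qed
  qed (auto simp: \<S>_def dest: openin_subset)
  then obtain \<W> where \<W>: "\<Union>\<W> = topspace X" "\<And>W. W \<in> \<W> \<Longrightarrow> \<exists>S\<in>\<S>. W \<subseteq> S"
    "locally_finite_in X \<W>"
    using paracompact_refine[OF X, of \<S>] \<S>_open by metis
  have "\<exists>V\<in>\<V>. X closure_of W \<subseteq> V" if "W \<in> \<W>" for W
    using \<W>(2)[OF that] closure_of_mono[of W _ X] unfolding \<S>_def by blast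
  then obtain v where v: "\<And>W. W \<in> \<W> \<Longrightarrow> v W \<in> \<V> \<and> X closure_of W \<subseteq> v W" by metis
  define F where "F V = (\<Union>W\<in>{W \<in> \<W>. v W = V}. X closure_of W)" for V
  have Fclosed: "closedin X (F V)" for V
    unfolding F_def
    by (intro closedin_Union_locally_finite_closure locally_finite_in_subset[OF \<W>(3)]) auto
  have FV: "F V \<subseteq> V" for V using v by (auto simp: F_def)
  define bump where "bump V h \<longleftrightarrow> continuous_map X euclideanreal h \<and> (\<forall>x\<in>topspace X. 0 \<le> h x) \<and>
      (\<forall>x\<in>topspace X - V. h x = 0) \<and> (\<forall>x\<in>F V. h x = 1)" for V and h :: "'a \<Rightarrow> real"
  have "\<exists>h. bump V h" if V: "V \<in> \<V>" for V
  proof -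
    obtain h where h: "continuous_map X (top_of_set {0..1::real}) h"
      "h ` (topspace X - V) \<subseteq> {0}" "h ` F V \<subseteq> {1}"
    proof (rule Urysohn_lemma[OF norm, of "topspace X - V" "F V" 0 1])
      show "closedin X (topspace X - V)" using \<V>(1)[OF V] by blast
      show "disjnt (topspace X - V) (F V)" using FV[of V] by (auto simp: disjnt_def)
    qed (use Fclosed in auto)
    have "h x \<in> {0..1}" if "x \<in> topspace X" for x
      using h(1) that by (auto simp: continuous_map_in_subtopology)
    moreover have "continuous_map X euclideanreal h"
      using h(1) by (rule continuous_map_into_fulltopology)
    ultimately show ?thesis
      using h(2,3) by (intro exI[of _ h]) (simp add: bump_def image_subset_iff)
  qed
  then obtain h where "\<And>V. V \<in> \<V> \<Longrightarrow> bump V (h V)" by metis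
  then have h: "\<And>V. V \<in> \<V> \<Longrightarrow> continuous_map X euclideanreal (h V)"
    "\<And>V x. V \<in> \<V> \<Longrightarrow> x \<in> topspace X \<Longrightarrow> 0 \<le> h V x"
    "\<And>V x. V \<in> \<V> \<Longrightarrow> x \<in> topspace X - V \<Longrightarrow> h V x = 0"
    "\<And>V x. V \<in> \<V> \<Longrightarrow> x \<in> F V \<Longrightarrow> h V x = 1"
    unfolding bump_def by blast+
  define s where "s x = (\<Sum>V | V \<in> \<V> \<and> x \<in> V. h V x)" for x
  have "continuous_map X euclideanreal s"
    unfolding s_def
    by (rule continuous_map_locally_finite_sum[OF _ _ \<V>(4) h(1,3)])
       (auto simp: case_prod_unfold intro!: continuous_intros continuous_map_fst continuous_map_snd)
  moreover have s_pos: "s x > 0" if x: "x \<in> topspace X" for x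
  proof -
    have "x \<in> \<Union>\<W>" using x \<W>(1) by simp
    then obtain W where W: "W \<in> \<W>" "x \<in> W" by blast
    then have xF: "x \<in> F (v W)"
      using closure_of_subset_Int[of X W] x by (auto simp: F_def)
    obtain N where "x \<in> N" "finite {V \<in> \<V>. V \<inter> N \<noteq> {}}"
      using \<V>(4) x unfolding locally_finite_in_def by blast
    then have "finite {V. V \<in> \<V> \<and> x \<in> V}" by (auto elim!: rev_finite_subset)
    moreover have "h (v W) x = 1" using h(4) v[OF W(1)] xF by blast
    ultimately have "1 \<le> s x"
      unfolding s_def using v[OF W(1)] xF FV h(2) x
      by (intro order_trans[OF _ member_le_sum[of "v W"]]) auto
    then show ?thesis by simp
  qed
  ultimately have "continuous_map X euclideanreal (\<lambda>x. h V x / s x)" if "V \<in> \<V>" for V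
    using h(1)[OF that] by (intro continuous_map_real_divide) (auto dest: s_pos)
  moreover have "(\<Sum>V | V \<in> \<V> \<and> x \<in> V. h V x / s x) = 1" if "x \<in> topspace X" for x
    using s_pos[OF that] by (simp add: sum_divide_distrib[symmetric] s_def[symmetric])
  ultimately show ?thesis
    using \<V>(3,4) h(2,3) s_pos by (intro that[of \<V> "\<lambda>V x. h V x / s x"]) (auto intro: divide_nonneg_pos)
qed

section \<open>Convex-valued selections in locally convex topologies\<close>


definition symmetric_convex_nhd :: "'a::real_vector topology \<Rightarrow> 'a set \<Rightarrow> bool" where
  "symmetric_convex_nhd \<tau> V \<longleftrightarrow> openin \<tau> V \<and> convex V \<and> 0 \<in> V \<and> (\<forall>v\<in>V. - v \<in> V)"

lemma lctvs_topspace: "Hausdorff_lctvs \<tau> \<Longrightarrow> topspace \<tau> = UNIV"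
  by (simp add: Hausdorff_lctvs_def)

lemma lctvs_continuous_add:
  assumes "Hausdorff_lctvs \<tau>" "continuous_map X \<tau> f" "continuous_map X \<tau> g"
  shows "continuous_map X \<tau> (\<lambda>x. f x + g x)"
proof -
  have "continuous_map X (prod_topology \<tau> \<tau>) (\<lambda>x. (f x, g x))"
    using assms by (simp add: continuous_map_pairwise o_def)
  then have "continuous_map X \<tau> ((\<lambda>(x, y). x + y) \<circ> (\<lambda>x. (f x, g x)))"
    using assms(1) continuous_map_compose unfolding Hausdorff_lctvs_def by blast
  then show ?thesis by (simp add: o_def)
qed

lemma lctvs_continuous_scale:
  assumes "Hausdorff_lctvs \<tau>" "continuous_map X euclideanreal c" "continuous_map X \<tau> f"
  shows "continuous_map X \<tau> (\<lambda>x. c x *\<^sub>R f x)"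
proof -
  have "continuous_map X (prod_topology euclideanreal \<tau>) (\<lambda>x. (c x, f x))"
    using assms by (simp add: continuous_map_pairwise o_def)
  then have "continuous_map X \<tau> ((\<lambda>(c, x). c *\<^sub>R x) \<circ> (\<lambda>x. (c x, f x)))"
    using assms(1) continuous_map_compose unfolding Hausdorff_lctvs_def by blast
  then show ?thesis by (simp add: o_def)
qed

lemma lctvs_openin_affine_preimage:
  assumes \<tau>: "Hausdorff_lctvs \<tau>" and f: "continuous_map X \<tau> f" and U: "openin \<tau> U"
  shows "openin X {x \<in> topspace X. c *\<^sub>R f x + b \<in> U}"
proof -
  have "continuous_map X \<tau> (\<lambda>x. c *\<^sub>R f x + b)"
    using f by (intro lctvs_continuous_add[OF \<tau>] lctvs_continuous_scale[OF \<tau>])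
      (auto simp: lctvs_topspace[OF \<tau>])
  then show ?thesis using U by (rule openin_continuous_map_preimage)
qed

lemma lctvs_openin_affine:
  assumes "Hausdorff_lctvs \<tau>" "openin \<tau> U"
  shows "openin \<tau> {x. c *\<^sub>R x + b \<in> U}"
  using lctvs_openin_affine_preimage[OF assms(1) continuous_map_id assms(2), of c b]
  by (simp add: lctvs_topspace[OF assms(1)])

text \<open>
  Local convexity is given by convex neighbourhoods that may fail to be open; passing to interiors
  makes them open.
\<close>

lemma lctvs_convex_interior:
  assumes \<tau>: "Hausdorff_lctvs \<tau>" and K: "convex K"
  shows "convex (\<tau> interior_of K)"
proof (rule convexI)
  fix x y and u v :: real
  assume x: "x \<in> \<tau> interior_of K" and y: "y \<in> \<tau> interior_of K" and uv: "0 \<le> u" "0 \<le> v" "u + v = 1"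
  show "u *\<^sub>R x + v *\<^sub>R y \<in> \<tau> interior_of K"
  proof (cases "u = 0")
    case True
    then show ?thesis using y uv by simp
  next
    case False
    \<comment> \<open>This is the set of all \<open>u *\<^sub>R x' + v *\<^sub>R y\<close> with \<open>x'\<close> in the interior, written as a preimage so that it is visibly open.\<close>
    define S where "S = {z. (1 / u) *\<^sub>R z + (- (v / u)) *\<^sub>R y \<in> \<tau> interior_of K}"
    have "openin \<tau> S" unfolding S_def by (intro lctvs_openin_affine \<tau>) simp
    moreover have "S \<subseteq> K"
    proof
      fix z assume z: "z \<in> S"
      define x' where "x' = (1 / u) *\<^sub>R z + (- (v / u)) *\<^sub>R y"
      have "x' \<in> K" "y \<in> K"
        using z y interior_of_subset[of \<tau> K] by (auto simp: S_def x'_def)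
      then have "u *\<^sub>R x' + v *\<^sub>R y \<in> K" using K uv by (intro convexD)
      moreover have "u *\<^sub>R x' + v *\<^sub>R y = z"
        using False by (simp add: x'_def scaleR_add_right scaleR_diff_right)
      ultimately show "z \<in> K" by simp
    qed
    moreover have "u *\<^sub>R x + v *\<^sub>R y \<in> S"
      using False x by (simp add: S_def scaleR_add_right)
    ultimately show ?thesis using interior_of_maximal by blast
  qed
qed

lemma lctvs_halving:
  assumes \<tau>: "Hausdorff_lctvs \<tau>" and W: "openin \<tau> W" "0 \<in> W"
  obtains V where "symmetric_convex_nhd \<tau> V" "\<And>u v. u \<in> V \<Longrightarrow> v \<in> V \<Longrightarrow> u + v \<in> W"
proof -
  have "openin \<tau> {x. 2 *\<^sub>R x + 0 \<in> W}" by (rule lctvs_openin_affine[OF \<tau> W(1)])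
  moreover have "0 \<in> {x. 2 *\<^sub>R x + 0 \<in> W}" using W by simp
  ultimately obtain U K where UK: "openin \<tau> U" "convex K" "0 \<in> U" "U \<subseteq> K" "K \<subseteq> {x. 2 *\<^sub>R x + 0 \<in> W}"
    using \<tau> unfolding Hausdorff_lctvs_def neighbourhood_base_of by meson
  define I where "I = \<tau> interior_of K"
  define V where "V = I \<inter> {x. (- 1) *\<^sub>R x + 0 \<in> I}"
  have I: "openin \<tau> I" "convex I" "0 \<in> I" "I \<subseteq> K"
    using UK lctvs_convex_interior[OF \<tau> UK(2)] interior_of_maximal[of U K \<tau>] interior_of_subset[of \<tau> K]
    by (auto simp: I_def)
  have "{x. (- 1) *\<^sub>R x + 0 \<in> I} = uminus -` I" by auto
  then have "convex V"
    unfolding V_def using I(2) by (auto intro!: convex_Int convex_linear_vimage linear_uminus)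
  then have "symmetric_convex_nhd \<tau> V"
    using I lctvs_openin_affine[OF \<tau> I(1), of "- 1" 0] by (auto simp: symmetric_convex_nhd_def V_def)
  moreover have "u + v \<in> W" if "u \<in> V" "v \<in> V" for u v
  proof -
    have "u \<in> K" "v \<in> K" using that I by (auto simp: V_def)
    then have "(1/2) *\<^sub>R u + (1/2) *\<^sub>R v \<in> K" using UK(2) by (intro convexD) auto
    then have "2 *\<^sub>R ((1/2) *\<^sub>R u + (1/2) *\<^sub>R v) \<in> W" using UK(5) by force
    then show ?thesis by (simp add: scaleR_add_right)
  qed
  ultimately show ?thesis using that by blast
qed

text \<open>
  Rescaling carries a countable base at the origin of the unit ball to a ball of radius \<open>R\<close>. With
  \<open>R = 2 * r\<close> it controls differences of points of the ball of radius \<open>r\<close>, which is how a base at a single point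
  gives uniform control on the whole ball.
\<close>

lemma lctvs_countable_base_on_ball:
  fixes \<tau> :: "'a::real_normed_vector topology"
  assumes \<tau>: "Hausdorff_lctvs \<tau>" and fc: "first_countable (subtopology \<tau> (cball 0 1))" and R: "R > 0"
  obtains V where "\<And>n::nat. symmetric_convex_nhd \<tau> (V n)"
    "\<And>n u v. u \<in> V (Suc n) \<Longrightarrow> v \<in> V (Suc n) \<Longrightarrow> u + v \<in> V n"
    "\<And>W. openin \<tau> W \<Longrightarrow> 0 \<in> W \<Longrightarrow> \<exists>n. V n \<inter> cball 0 R \<subseteq> W"
proof -
  let ?S = "subtopology \<tau> (cball 0 1)"
  have "0 \<in> topspace ?S" by (simp add: lctvs_topspace[OF \<tau>])
  then obtain \<B> where \<B>: "countable \<B>" "\<And>B. B \<in> \<B> \<Longrightarrow> openin ?S B"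
    "\<And>U. openin ?S U \<Longrightarrow> 0 \<in> U \<Longrightarrow> \<exists>B\<in>\<B>. 0 \<in> B \<and> B \<subseteq> U"
    using fc unfolding first_countable_def by metis
  define \<B>0 where "\<B>0 = {B \<in> \<B>. 0 \<in> B}"
  have ne: "\<B>0 \<noteq> {}" using \<B>(3)[OF openin_topspace] \<open>0 \<in> topspace ?S\<close> by (auto simp: \<B>0_def)
  have count: "countable \<B>0" using \<B>(1) by (simp add: \<B>0_def)
  define B where "B = from_nat_into \<B>0"
  have B: "B n \<in> \<B>0" for n using ne by (simp add: B_def from_nat_into)
  have "\<exists>T. openin \<tau> T \<and> B n = T \<inter> cball 0 1" for n
    using B[of n] \<B>(2)[of "B n"] by (auto simp: \<B>0_def openin_subtopology)
  then obtain T where T: "\<And>n. openin \<tau> (T n)" "\<And>n. B n = T n \<inter> cball 0 1" by metis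
  define N where "N n = {z. (1 / R) *\<^sub>R z + 0 \<in> T n}" for n
  have N: "openin \<tau> (N n)" "0 \<in> N n" for n
    unfolding N_def
    by (rule lctvs_openin_affine[OF \<tau> T(1)]) (use B[of n] T(2)[of n] in \<open>auto simp: \<B>0_def\<close>)
  have base: "\<exists>n. N n \<inter> cball 0 R \<subseteq> W" if W: "openin \<tau> W" "0 \<in> W" for W
  proof -
    have "openin ?S ({x. R *\<^sub>R x + 0 \<in> W} \<inter> cball 0 1)"
      using lctvs_openin_affine[OF \<tau> W(1), of R 0] by (auto simp: openin_subtopology)
    then obtain B' where B': "B' \<in> \<B>0" "B' \<subseteq> {x. R *\<^sub>R x + 0 \<in> W}"
      using \<B>(3)[of "{x. R *\<^sub>R x + 0 \<in> W} \<inter> cball 0 1"] W(2) by (auto simp: \<B>0_def)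
    obtain n where n: "B n = B'"
      using from_nat_into_surj[OF count B'(1)] by (auto simp: B_def)
    have "z \<in> W" if z: "z \<in> N n" "z \<in> cball 0 R" for z
    proof -
      have "(1 / R) *\<^sub>R z \<in> B n" using z R by (simp add: T(2) N_def field_simps)
      then have "R *\<^sub>R ((1 / R) *\<^sub>R z) \<in> W" using n B'(2) by force
      then show ?thesis using R by simp
    qed
    then show ?thesis by blast
  qed
  have "\<exists>V. \<forall>n. (symmetric_convex_nhd \<tau> (V n) \<and> V n \<subseteq> N n) \<and>
      (\<forall>u\<in>V (Suc n). \<forall>v\<in>V (Suc n). u + v \<in> V n)"
  proof (rule dependent_nat_choice)
    obtain V where "symmetric_convex_nhd \<tau> V" "\<And>u v. u \<in> V \<Longrightarrow> v \<in> V \<Longrightarrow> u + v \<in> N 0"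
      using lctvs_halving[OF \<tau> N(1,2)[of 0]] by blast
    then show "\<exists>V. symmetric_convex_nhd \<tau> V \<and> V \<subseteq> N 0"
      by (intro exI[of _ V]) (force simp: symmetric_convex_nhd_def dest: meta_spec[of _ 0])
  next
    fix V n assume V: "symmetric_convex_nhd \<tau> V \<and> V \<subseteq> N n"
    have "openin \<tau> (V \<inter> N (Suc n))" "0 \<in> V \<inter> N (Suc n)"
      using V N[of "Suc n"] by (auto simp: symmetric_convex_nhd_def)
    then obtain V' where V': "symmetric_convex_nhd \<tau> V'" "\<And>u v. u \<in> V' \<Longrightarrow> v \<in> V' \<Longrightarrow> u + v \<in> V \<inter> N (Suc n)"
      using lctvs_halving[OF \<tau>] by blast
    moreover have "v \<in> N (Suc n)" if "v \<in> V'" for v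
      using V'(2)[OF that, of 0] V'(1) by (simp add: symmetric_convex_nhd_def)
    ultimately show "\<exists>V'. (symmetric_convex_nhd \<tau> V' \<and> V' \<subseteq> N (Suc n)) \<and> (\<forall>u\<in>V'. \<forall>v\<in>V'. u + v \<in> V)"
      by (intro exI[of _ V']) blast
  qed
  then obtain V where V: "\<And>n. symmetric_convex_nhd \<tau> (V n)" "\<And>n. V n \<subseteq> N n"
    "\<And>n. \<forall>u\<in>V (Suc n). \<forall>v\<in>V (Suc n). u + v \<in> V n"
    by blast
  have "\<exists>n. V n \<inter> cball 0 R \<subseteq> W" if "openin \<tau> W" "0 \<in> W" for W
  proof -
    obtain n where "N n \<inter> cball 0 R \<subseteq> W" using base[OF \<open>openin \<tau> W\<close> \<open>0 \<in> W\<close>] by blast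
    then have "V n \<inter> cball 0 R \<subseteq> W" using V(2)[of n] by blast
    then show ?thesis ..
  qed
  then show ?thesis using that[of V] V(1,3) by blast
qed

definition lsc_multimap :: "'b topology \<Rightarrow> 'a topology \<Rightarrow> ('b \<Rightarrow> 'a set) \<Rightarrow> bool" where
  "lsc_multimap X \<tau> \<Psi> \<longleftrightarrow> (\<forall>U. openin \<tau> U \<longrightarrow> openin X {x \<in> topspace X. \<Psi> x \<inter> U \<noteq> {}})"

text \<open>
  The sets of all \<open>x\<close> for which \<open>\<Psi> x\<close> comes \<open>N\<close>-close to a fixed \<open>y\<close> form an open cover. Averaging the
  points \<open>y\<close> with a subordinate partition of unity stays close to \<open>\<Psi> x\<close> because both \<open>\<Psi> x\<close> and \<open>N\<close> are convex.
\<close>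

lemma approximate_convex_selection:
  fixes \<tau> :: "'a::real_vector topology"
  assumes X: "paracompact_space X" and \<tau>: "Hausdorff_lctvs \<tau>" and N: "symmetric_convex_nhd \<tau> N"
    and B: "convex B" and \<Psi>: "lsc_multimap X \<tau> \<Psi>"
    and conv: "\<And>x. x \<in> topspace X \<Longrightarrow> convex (\<Psi> x)"
    and ne: "\<And>x. x \<in> topspace X \<Longrightarrow> \<Psi> x \<noteq> {}" and sub: "\<And>x. x \<in> topspace X \<Longrightarrow> \<Psi> x \<subseteq> B"
  obtains f where "continuous_map X \<tau> f" "\<And>x. x \<in> topspace X \<Longrightarrow> f x \<in> B"
    "\<And>x. x \<in> topspace X \<Longrightarrow> \<exists>y\<in>\<Psi> x. f x - y \<in> N"
proof -
  define G where "G y = {x \<in> topspace X. \<Psi> x \<inter> {z. (- 1) *\<^sub>R z + y \<in> N} \<noteq> {}}" for y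
  have openG: "openin X (G y)" for y
    using \<Psi> lctvs_openin_affine[OF \<tau>, of N "- 1" y] N
    unfolding G_def lsc_multimap_def symmetric_convex_nhd_def by blast
  have openGB: "openin X U" if "U \<in> G ` B" for U
    using that openG by auto
  have "x \<in> \<Union>(G ` B)" if x: "x \<in> topspace X" for x
  proof -
    obtain y where "y \<in> \<Psi> x" using ne[OF x] by blast
    moreover have "(- 1) *\<^sub>R y + y \<in> N" using N by (simp add: symmetric_convex_nhd_def)
    ultimately have "x \<in> G y" using x by (auto simp: G_def)
    then show ?thesis using \<open>y \<in> \<Psi> x\<close> sub[OF x] by blast
  qed
  then have cover: "\<Union>(G ` B) = topspace X" by (auto simp: G_def)
  obtain \<V> and \<phi> :: "'b set \<Rightarrow> 'b \<Rightarrow> real" where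
    lf: "locally_finite_in X \<V>" and ref: "\<And>V. V \<in> \<V> \<Longrightarrow> \<exists>U\<in>G ` B. V \<subseteq> U" and
    cont: "\<And>V. V \<in> \<V> \<Longrightarrow> continuous_map X euclideanreal (\<phi> V)" and
    nonneg: "\<And>V x. V \<in> \<V> \<Longrightarrow> x \<in> topspace X \<Longrightarrow> 0 \<le> \<phi> V x" and
    supp: "\<And>V x. V \<in> \<V> \<Longrightarrow> x \<in> topspace X - V \<Longrightarrow> \<phi> V x = 0" and
    sum1: "\<And>x. x \<in> topspace X \<Longrightarrow> (\<Sum>V | V \<in> \<V> \<and> x \<in> V. \<phi> V x) = 1"
    using paracompact_partition_of_unity[OF X openGB cover] by blast
  have "\<exists>y\<in>B. V \<subseteq> G y" if "V \<in> \<V>" for V using ref[OF that] by blast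
  then obtain y where y: "\<And>V. V \<in> \<V> \<Longrightarrow> y V \<in> B" "\<And>V. V \<in> \<V> \<Longrightarrow> V \<subseteq> G (y V)" by metis
  define f where "f x = (\<Sum>V | V \<in> \<V> \<and> x \<in> V. \<phi> V x *\<^sub>R y V)" for x
  \<comment> \<open>A sum over an infinite set would be 0.\<close>
  have fin: "finite {V. V \<in> \<V> \<and> x \<in> V}" if x: "x \<in> topspace X" for x
  proof (rule ccontr)
    assume "infinite {V. V \<in> \<V> \<and> x \<in> V}"
    then show False using sum1[OF x] by simp
  qed
  show ?thesis
  proof (rule that)
    show "continuous_map X \<tau> f"
      unfolding f_def
    proof (rule continuous_map_locally_finite_sum[OF _ _ lf])
      show "continuous_map (prod_topology \<tau> \<tau>) \<tau> (\<lambda>(a, b). a + b)" "0 \<in> topspace \<tau>"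
        using \<tau> by (auto simp: Hausdorff_lctvs_def)
      show "continuous_map X \<tau> (\<lambda>x. \<phi> V x *\<^sub>R y V)" if "V \<in> \<V>" for V
        using cont[OF that] by (intro lctvs_continuous_scale[OF \<tau>]) (auto simp: lctvs_topspace[OF \<tau>])
    qed (simp add: supp)
  next
    fix x assume x: "x \<in> topspace X"
    show "f x \<in> B"
      unfolding f_def using x fin B sum1 nonneg y by (intro convex_sum) auto
    have "\<exists>z\<in>\<Psi> x. y V - z \<in> N" if "V \<in> \<V>" "x \<in> V" for V
      using y(2)[OF that(1)] that by (auto simp: G_def)
    then obtain z where z: "\<And>V. V \<in> \<V> \<Longrightarrow> x \<in> V \<Longrightarrow> z V \<in> \<Psi> x \<and> y V - z V \<in> N" by metis
    have "(\<Sum>V | V \<in> \<V> \<and> x \<in> V. \<phi> V x *\<^sub>R z V) \<in> \<Psi> x"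
      using x fin conv sum1 nonneg z by (intro convex_sum) auto
    moreover have "(\<Sum>V | V \<in> \<V> \<and> x \<in> V. \<phi> V x *\<^sub>R (y V - z V)) \<in> N"
      using x fin N sum1 nonneg z by (intro convex_sum) (auto simp: symmetric_convex_nhd_def)
    then have "f x - (\<Sum>V | V \<in> \<V> \<and> x \<in> V. \<phi> V x *\<^sub>R z V) \<in> N"
      by (simp add: f_def scaleR_diff_right sum_subtractf)
    ultimately show "\<exists>y\<in>\<Psi> x. f x - y \<in> N" by blast
  qed
qed

text \<open>
  The induction step of the selection theorem: restricting to the part of \<open>\<Psi> x\<close> near an approximate
  selection keeps lower semicontinuity, since the neighbourhood \<open>V\<close> is open.
\<close>

lemma lsc_multimap_restrict_near:
  fixes \<tau> :: "'a::real_vector topology"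
  assumes \<tau>: "Hausdorff_lctvs \<tau>" and V: "openin \<tau> V"
    and \<Psi>: "lsc_multimap X \<tau> \<Psi>" and f: "continuous_map X \<tau> f"
  shows "lsc_multimap X \<tau> (\<lambda>x. {y \<in> \<Psi> x. f x - y \<in> V})"
  unfolding lsc_multimap_def
proof (intro allI impI)
  fix U assume U: "openin \<tau> U"
  let ?S = "{x \<in> topspace X. {y \<in> \<Psi> x. f x - y \<in> V} \<inter> U \<noteq> {}}"
  have "\<exists>T. openin X T \<and> x0 \<in> T \<and> T \<subseteq> ?S" if x0: "x0 \<in> ?S" for x0
  proof -
    obtain y0 where y0: "x0 \<in> topspace X" "y0 \<in> \<Psi> x0" "f x0 - y0 \<in> V" "y0 \<in> U"
      using x0 by blast
    have "openin \<tau> {v. 1 *\<^sub>R v + (f x0 - y0) \<in> V}" by (rule lctvs_openin_affine[OF \<tau> V])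
    then obtain V' where V': "symmetric_convex_nhd \<tau> V'"
      "\<And>u v. u \<in> V' \<Longrightarrow> v \<in> V' \<Longrightarrow> u + v + (f x0 - y0) \<in> V"
      using lctvs_halving[OF \<tau>, of "{v. 1 *\<^sub>R v + (f x0 - y0) \<in> V}"] y0(3) by auto
    define P where "P = {x \<in> topspace X. 1 *\<^sub>R f x + (- f x0) \<in> V'}"
    define U' where "U' = U \<inter> {z. (- 1) *\<^sub>R z + y0 \<in> V'}"
    define Q where "Q = {x \<in> topspace X. \<Psi> x \<inter> U' \<noteq> {}}"
    have V'0: "openin \<tau> V'" "0 \<in> V'" using V'(1) by (auto simp: symmetric_convex_nhd_def)
    have "openin X P" unfolding P_def by (rule lctvs_openin_affine_preimage[OF \<tau> f V'0(1)])
    moreover have "openin \<tau> U'"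
      unfolding U'_def by (intro openin_Int U lctvs_openin_affine[OF \<tau> V'0(1)])
    then have "openin X Q" using \<Psi> unfolding lsc_multimap_def Q_def by blast
    ultimately have "openin X (P \<inter> Q)" by blast
    moreover have "x0 \<in> P \<inter> Q" using y0 V'0 by (auto simp: P_def Q_def U'_def)
    moreover have "P \<inter> Q \<subseteq> ?S"
    proof
      fix x assume x: "x \<in> P \<inter> Q"
      then obtain y where y: "y \<in> \<Psi> x" "y \<in> U" "y0 - y \<in> V'" by (auto simp: Q_def U'_def)
      have "(f x - f x0) + (y0 - y) + (f x0 - y0) \<in> V" using x y by (intro V'(2)) (auto simp: P_def)
      then have "f x - y \<in> V" by (simp add: algebra_simps)
      then show "x \<in> ?S" using x y by (auto simp: P_def)
    qed
    ultimately show ?thesis by blast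
  qed
  then show "openin X ?S" by (subst openin_subopen) blast
qed

text \<open>
  A form of Michael's selection theorem in which the sets \<open>V n\<close> play the role of balls with
  halving radii. Each approximate selection is chosen for the part of \<open>\<Psi>\<close> near the previous one, so all
  later corrections together stay in a prescribed \<open>V n\<close> and the convergence is uniform. The limit lies in the closure
  of \<open>\<Psi> x\<close>, which is expressed through the \<open>V k\<close>.
\<close>

theorem convex_selection:
  fixes \<tau> :: "'a::real_vector topology"
  assumes X: "paracompact_space X" and \<tau>: "Hausdorff_lctvs \<tau>"
    and V: "\<And>n::nat. symmetric_convex_nhd \<tau> (V n)"
    and half: "\<And>n u v. u \<in> V (Suc n) \<Longrightarrow> v \<in> V (Suc n) \<Longrightarrow> u + v \<in> V n"
    and B: "convex B"
    and base: "\<And>W. openin \<tau> W \<Longrightarrow> 0 \<in> W \<Longrightarrow> \<exists>n. \<forall>u\<in>B. \<forall>v\<in>B. u - v \<in> V n \<longrightarrow> u - v \<in> W"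
    and complete: "\<And>y. (\<And>n::nat. y n \<in> B) \<Longrightarrow> (\<And>k. \<exists>N. \<forall>m\<ge>N. \<forall>n\<ge>N. y m - y n \<in> V k) \<Longrightarrow>
      \<exists>z\<in>B. \<forall>k. \<exists>N. \<forall>n\<ge>N. y n - z \<in> V k"
    and \<Psi>: "lsc_multimap X \<tau> \<Psi>"
    and conv: "\<And>x. x \<in> topspace X \<Longrightarrow> convex (\<Psi> x)"
    and ne: "\<And>x. x \<in> topspace X \<Longrightarrow> \<Psi> x \<noteq> {}" and sub: "\<And>x. x \<in> topspace X \<Longrightarrow> \<Psi> x \<subseteq> B"
  obtains f where "continuous_map X \<tau> f" "\<And>x. x \<in> topspace X \<Longrightarrow> f x \<in> B"
    "\<And>x k. x \<in> topspace X \<Longrightarrow> \<exists>y\<in>\<Psi> x. f x - y \<in> V k"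
proof -
  have V0: "0 \<in> V n" and Vneg: "v \<in> V n \<Longrightarrow> - v \<in> V n" and Vopen: "openin \<tau> (V n)"
    and Vconv: "convex (V n)" for n v
    using V[of n] by (auto simp: symmetric_convex_nhd_def)
  have Vdec: "V (Suc n) \<subseteq> V n" for n using half[of _ n 0] V0 by auto
  have Vle: "V n \<subseteq> V m" if "m \<le> n" for m n using Vdec that by (rule lift_Suc_antimono_le)
  define good where "good n f \<longleftrightarrow> continuous_map X \<tau> f \<and>
    (\<forall>x\<in>topspace X. f x \<in> B \<and> (\<exists>y\<in>\<Psi> x. f x - y \<in> V n))" for n and f :: "'b \<Rightarrow> 'a"
  have "\<exists>f. \<forall>n. good n (f n) \<and>
      (\<forall>x\<in>topspace X. \<exists>y. f n x - y \<in> V n \<and> f (Suc n) x - y \<in> V (Suc n))"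
  proof (rule dependent_nat_choice)
    show "\<exists>f. good 0 f"
      using approximate_convex_selection[OF X \<tau> V[of 0] B \<Psi> conv ne sub] unfolding good_def by metis
  next
    fix f n assume f: "good n f"
    define \<Psi>' where "\<Psi>' x = {y \<in> \<Psi> x. f x - y \<in> V n}" for x
    have "lsc_multimap X \<tau> \<Psi>'"
      unfolding \<Psi>'_def using f by (intro lsc_multimap_restrict_near \<tau> Vopen \<Psi>) (simp add: good_def)
    moreover have "convex (\<Psi>' x)" if "x \<in> topspace X" for x
    proof -
      have "\<Psi>' x = \<Psi> x \<inter> (\<lambda>v. f x - v) ` V n" by (force simp: \<Psi>'_def image_iff)
      moreover have "convex ((\<lambda>v. f x - v) ` V n)"
        using convex_translation[OF convex_negations[OF Vconv[of n]], of "f x"]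
        by (simp add: image_image)
      ultimately show ?thesis using conv[OF that] by (simp add: convex_Int)
    qed
    moreover have "\<Psi>' x \<noteq> {}" "\<Psi>' x \<subseteq> B" if "x \<in> topspace X" for x
      using f sub[OF that] that by (auto simp: \<Psi>'_def good_def)
    ultimately obtain h where h: "continuous_map X \<tau> h" "\<And>x. x \<in> topspace X \<Longrightarrow> h x \<in> B"
      "\<And>x. x \<in> topspace X \<Longrightarrow> \<exists>y\<in>\<Psi>' x. h x - y \<in> V (Suc n)"
      using approximate_convex_selection[OF X \<tau> V[of "Suc n"] B, of \<Psi>'] by blast
    have "good (Suc n) h" unfolding good_def using h by (auto simp: \<Psi>'_def)
    moreover have "\<forall>x\<in>topspace X. \<exists>y. f x - y \<in> V n \<and> h x - y \<in> V (Suc n)"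
      using h(3) by (auto simp: \<Psi>'_def)
    ultimately show "\<exists>h. good (Suc n) h \<and> (\<forall>x\<in>topspace X. \<exists>y. f x - y \<in> V n \<and> h x - y \<in> V (Suc n))"
      by blast
  qed
  then obtain f where "\<And>n. good n (f n)"
    and near: "\<And>n x. x \<in> topspace X \<Longrightarrow> \<exists>y. f n x - y \<in> V n \<and> f (Suc n) x - y \<in> V (Suc n)"
    by blast
  then have f: "\<And>n. continuous_map X \<tau> (f n)" "\<And>n x. x \<in> topspace X \<Longrightarrow> f n x \<in> B"
    "\<And>n x. x \<in> topspace X \<Longrightarrow> \<exists>y\<in>\<Psi> x. f n x - y \<in> V n"
    unfolding good_def by blast+
  have step: "f (Suc (Suc n)) x - f (Suc n) x \<in> V n" if x: "x \<in> topspace X" for n x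
  proof -
    obtain y where y: "f (Suc n) x - y \<in> V (Suc n)" "f (Suc (Suc n)) x - y \<in> V (Suc (Suc n))"
      using near[OF x, of "Suc n"] by blast
    then have "(f (Suc (Suc n)) x - y) + (- (f (Suc n) x - y)) \<in> V n"
      using Vdec[of "Suc n"] by (intro half Vneg) auto
    then show ?thesis by simp
  qed
  \<comment> \<open>Peeling off the first step lets the induction hypothesis at \<open>Suc m\<close> absorb all later ones in a single halving.\<close>
  have tail: "f (m + 2 + j) x - f (m + 2) x \<in> V m" if x: "x \<in> topspace X" for m j x
  proof (induction j arbitrary: m)
    case 0
    then show ?case using V0 by simp
  next
    case (Suc j)
    have "(f (Suc m + 2 + j) x - f (Suc m + 2) x) + (f (Suc (Suc (Suc m))) x - f (Suc (Suc m)) x) \<in> V m"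
      using Suc[of "Suc m"] step[OF x, of "Suc m"] by (intro half)
    then show ?case by simp
  qed
  have "\<exists>z\<in>B. \<forall>k. \<exists>N. \<forall>n\<ge>N. f n x - z \<in> V k" if x: "x \<in> topspace X" for x
  proof (rule complete)
    show "f n x \<in> B" for n using f(2)[OF x] .
    fix k
    have to3: "f p x - f (k + 3) x \<in> V (Suc k)" if p: "p \<ge> k + 3" for p
    proof -
      obtain j where "p = k + 3 + j" using le_Suc_ex[OF p] by blast
      then show ?thesis using tail[OF x, of "Suc k" j] by (simp add: eval_nat_numeral)
    qed
    have "f m x - f n x \<in> V k" if mn: "m \<ge> k + 3" "n \<ge> k + 3" for m n
    proof -
      have "f m x - f (k + 3) x \<in> V (Suc k)" "f n x - f (k + 3) x \<in> V (Suc k)"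
        using to3 mn by auto
      then have "(f m x - f (k + 3) x) + (- (f n x - f (k + 3) x)) \<in> V k" by (intro half Vneg)
      then show ?thesis by simp
    qed
    then show "\<exists>N. \<forall>m\<ge>N. \<forall>n\<ge>N. f m x - f n x \<in> V k" by blast
  qed
  then obtain F where F: "\<And>x. x \<in> topspace X \<Longrightarrow> F x \<in> B"
    "\<And>x k. x \<in> topspace X \<Longrightarrow> \<exists>N. \<forall>n\<ge>N. f n x - F x \<in> V k"
    by metis
  have unif: "f (n + 3) x - F x \<in> V n" if x: "x \<in> topspace X" for n x
  proof -
    obtain N where N: "\<And>m. m \<ge> N \<Longrightarrow> f m x - F x \<in> V (Suc n)" using F(2)[OF x] by blast
    have "f (n + 3 + N) x - f (n + 3) x \<in> V (Suc n)" using tail[OF x, of "Suc n" N] by (simp add: eval_nat_numeral)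
    then have "(- (f (n + 3 + N) x - f (n + 3) x)) + (f (n + 3 + N) x - F x) \<in> V n"
      by (intro half Vneg N) auto
    then show ?thesis by simp
  qed
  have "continuous_map X \<tau> F"
    unfolding continuous_map_def
  proof (intro conjI allI impI)
    show "F \<in> topspace X \<rightarrow> topspace \<tau>" by (simp add: lctvs_topspace[OF \<tau>])
    fix W assume W: "openin \<tau> W"
    have "\<exists>T. openin X T \<and> x0 \<in> T \<and> T \<subseteq> {x \<in> topspace X. F x \<in> W}"
      if "x0 \<in> {x \<in> topspace X. F x \<in> W}" for x0
    proof -
      have x0: "x0 \<in> topspace X" "F x0 \<in> W" using that by auto
      have "openin \<tau> {z. 1 *\<^sub>R z + F x0 \<in> W}" by (rule lctvs_openin_affine[OF \<tau> W])
      from base[OF this] x0 obtain k where k: "\<And>u v. u \<in> B \<Longrightarrow> v \<in> B \<Longrightarrow> u - v \<in> V k \<Longrightarrow> u - v + F x0 \<in> W"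
        by auto
      define h where "h = f (Suc (Suc k) + 3)"
      have h: "h x - F x \<in> V (Suc (Suc k))" if "x \<in> topspace X" for x
        unfolding h_def by (rule unif[OF that])
      define T where "T = {x \<in> topspace X. 1 *\<^sub>R h x + (- h x0) \<in> V (Suc (Suc k))}"
      have "openin X T"
        unfolding T_def h_def by (rule lctvs_openin_affine_preimage[OF \<tau> f(1) Vopen])
      moreover have "x0 \<in> T" using x0 V0 by (simp add: T_def)
      moreover have "F x \<in> W" if x: "x \<in> T" for x
      proof -
        have xX: "x \<in> topspace X" using x by (simp add: T_def)
        have "(- (h x - F x)) + (h x - h x0) \<in> V (Suc k)"
          using h[OF xX] x by (intro half Vneg) (auto simp: T_def)
        moreover have "h x0 - F x0 \<in> V (Suc k)" using h[OF x0(1)] Vdec by blast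
        ultimately have "(- (h x - F x)) + (h x - h x0) + (h x0 - F x0) \<in> V k" by (rule half)
        then have "F x - F x0 \<in> V k" by simp
        then show ?thesis using k[of "F x" "F x0"] F(1) xX x0 by simp
      qed
      ultimately show ?thesis by (auto simp: T_def)
    qed
    then show "openin X {x \<in> topspace X. F x \<in> W}" by (subst openin_subopen) blast
  qed
  moreover have "\<exists>y\<in>\<Psi> x. F x - y \<in> V k" if x: "x \<in> topspace X" for x k
  proof -
    obtain y where y: "y \<in> \<Psi> x" "f (Suc k + 3) x - y \<in> V (Suc k + 3)" using f(3)[OF x] by blast
    then have "f (Suc k + 3) x - y \<in> V (Suc k)" using Vle[of "Suc k" "Suc k + 3"] by auto
    then have "(- (f (Suc k + 3) x - F x)) + (f (Suc k + 3) x - y) \<in> V k"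
      using unif[OF x, of "Suc k"] by (intro half Vneg)
    then show ?thesis using y by auto
  qed
  ultimately show ?thesis using F(1) that by blast
qed

section \<open>Extending selections of the slices\<close>


lemma openin_weak_topology_vimage:
  fixes f :: "'a::real_normed_vector \<Rightarrow>\<^sub>L real"
  assumes "open U"
  shows "openin weak_topology (blinfun_apply f -` U)"
  unfolding weak_topology_def
  using assms by (intro topology_generated_by_Basis) blast

text \<open>
  Evaluation at \<open>y\<close> is one of the bidual functionals that generate the weak topology of the dual.
\<close>

lemma weakly_continuous_apply:
  fixes A :: "'b \<Rightarrow> ('a::real_normed_vector \<Rightarrow>\<^sub>L real)"
  assumes A: "continuous_map X weak_topology A"
  shows "continuous_map X euclideanreal (\<lambda>x. blinfun_apply (A x) y)"
  unfolding continuous_map_def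
proof (intro conjI allI impI)
  fix U :: "real set" assume "openin euclideanreal U"
  then have U: "open U" by simp
  define ev where "ev = Blinfun (\<lambda>f :: 'a \<Rightarrow>\<^sub>L real. blinfun_apply f y)"
  have ev: "blinfun_apply ev f = blinfun_apply f y" for f
    unfolding ev_def
    by (rule fun_cong[OF bounded_linear_Blinfun_apply[OF blinfun.bounded_linear_left]])
  show "openin X {x \<in> topspace X. blinfun_apply (A x) y \<in> U}"
    using openin_continuous_map_preimage[OF A openin_weak_topology_vimage[OF U, of ev]]
    by (simp add: ev)
qed auto

text \<open>
  Functionals are continuous for the finer topology \<open>\<tau>\<close>, so the sequence is weakly Cauchy and has a
  weak limit \<open>z\<close>. The differences \<open>y n - y m\<close> lie in the convex set \<open>V (Suc k)\<close> and converge weakly to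
  \<open>y n - z\<close> as \<open>m\<close> grows; this limit is approximated in norm by elements of \<open>V (Suc k)\<close>, and the error can
  be taken inside \<open>V (Suc k)\<close>, which is open for the norm.
\<close>

lemma admissible_ball_sequentially_complete:
  fixes \<tau> :: "'a::real_normed_vector topology"
  assumes refl: "reflexive_space TYPE('a)"
    and finer: "\<And>U. openin weak_topology U \<Longrightarrow> openin \<tau> U" and coarser: "\<And>U. openin \<tau> U \<Longrightarrow> open U"
    and V: "\<And>n::nat. symmetric_convex_nhd \<tau> (V n)"
    and half: "\<And>n u v. u \<in> V (Suc n) \<Longrightarrow> v \<in> V (Suc n) \<Longrightarrow> u + v \<in> V n"
    and base: "\<And>W. openin \<tau> W \<Longrightarrow> 0 \<in> W \<Longrightarrow> \<exists>n. V n \<inter> cball 0 (2 * r) \<subseteq> W"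
    and bound: "\<And>n::nat. norm (y n) \<le> r"
    and Cauchy: "\<And>k. \<exists>N. \<forall>m\<ge>N. \<forall>n\<ge>N. y m - y n \<in> V k"
  shows "\<exists>z. norm z \<le> r \<and> (\<forall>k. \<exists>N. \<forall>n\<ge>N. y n - z \<in> V k)"
proof -
  have "Cauchy (\<lambda>n. blinfun_apply f (y n))" for f :: "'a \<Rightarrow>\<^sub>L real"
  proof (rule metric_CauchyI)
    fix e :: real assume e: "e > 0"
    have "openin \<tau> (blinfun_apply f -` ball 0 e)"
      by (intro finer openin_weak_topology_vimage open_ball)
    from base[OF this] e obtain k where k: "V k \<inter> cball 0 (2 * r) \<subseteq> blinfun_apply f -` ball 0 e"
      by (auto simp: blinfun.zero_right)
    obtain N where N: "\<And>m n. m \<ge> N \<Longrightarrow> n \<ge> N \<Longrightarrow> y m - y n \<in> V k" using Cauchy by blast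
    have "dist (blinfun_apply f (y m)) (blinfun_apply f (y n)) < e" if "m \<ge> N" "n \<ge> N" for m n
    proof -
      have "norm (y m - y n) \<le> 2 * r"
        using norm_triangle_ineq4[of "y m" "y n"] bound[of m] bound[of n] by simp
      then have "y m - y n \<in> blinfun_apply f -` ball 0 e" using N[OF that] k by auto
      then show ?thesis by (simp add: blinfun.diff_right dist_norm)
    qed
    then show "\<exists>N. \<forall>m\<ge>N. \<forall>n\<ge>N. dist (blinfun_apply f (y m)) (blinfun_apply f (y n)) < e" by blast
  qed
  then obtain z where z: "norm z \<le> r"
    "\<And>f :: 'a \<Rightarrow>\<^sub>L real. (\<lambda>n. blinfun_apply f (y n)) \<longlonglongrightarrow> blinfun_apply f z"
    using reflexive_weakly_Cauchy_converges[OF refl, of y r] bound by blast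
  have "\<exists>N. \<forall>n\<ge>N. y n - z \<in> V k" for k
  proof -
    have V': "convex (V (Suc k))" "0 \<in> V (Suc k)" "open (V (Suc k))"
      using V[of "Suc k"] coarser by (auto simp: symmetric_convex_nhd_def)
    then obtain e where e: "e > 0" "ball 0 e \<subseteq> V (Suc k)" by (meson open_contains_ball)
    obtain N where N: "\<And>m n. m \<ge> N \<Longrightarrow> n \<ge> N \<Longrightarrow> y m - y n \<in> V (Suc k)" using Cauchy by blast
    have "y n - z \<in> V k" if n: "n \<ge> N" for n
    proof -
      have "(\<lambda>m. blinfun_apply f (y n - y m)) \<longlonglongrightarrow> blinfun_apply f (y n - z)" for f :: "'a \<Rightarrow>\<^sub>L real"
        unfolding blinfun.diff_right by (intro tendsto_intros z)
      then obtain v where v: "v \<in> V (Suc k)" "dist (y n - z) v < e"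
        using weak_limit_of_convex_near[OF V'(1), of N "\<lambda>m. y n - y m" e "y n - z"] N n e(1) by blast
      then have "(y n - z) - v \<in> V (Suc k)" using e(2) by (auto simp: dist_norm)
      then have "v + ((y n - z) - v) \<in> V k" using v(1) by (intro half)
      then show ?thesis by simp
    qed
    then show ?thesis by blast
  qed
  then show ?thesis using z(1) by blast
qed

text \<open>
  The perturbation estimate asks for closeness at three points only, and evaluation at a point is
  continuous along \<open>A\<close>.
\<close>

lemma hyperplane_ball_lsc:
  fixes A :: "'b \<Rightarrow> ('a::real_normed_vector \<Rightarrow>\<^sub>L real)"
  assumes attained: "\<And>f :: 'a \<Rightarrow>\<^sub>L real. \<exists>z. norm z \<le> 1 \<and> blinfun_apply f z = norm f"
    and luc: "locally_uniformly_convex TYPE('a)"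
    and A: "continuous_map X weak_topology A" and \<alpha>: "continuous_map X euclideanreal \<alpha>"
    and r: "r > 0" and bound: "\<And>x. x \<in> topspace X \<Longrightarrow> \<bar>\<alpha> x\<bar> \<le> r * norm (A x)"
    and nz: "\<And>x. x \<in> topspace X \<Longrightarrow> A x \<noteq> 0"
  shows "lsc_multimap X euclidean (\<lambda>x. {y. norm y \<le> r \<and> blinfun_apply (A x) y = \<alpha> x})"
  unfolding lsc_multimap_def
proof (intro allI impI)
  fix U :: "'a set" assume "openin euclidean U"
  then have U: "open U" by simp
  let ?S = "{x \<in> topspace X. {y. norm y \<le> r \<and> blinfun_apply (A x) y = \<alpha> x} \<inter> U \<noteq> {}}"
  have "\<exists>T. openin X T \<and> x0 \<in> T \<and> T \<subseteq> ?S" if x0S: "x0 \<in> ?S" for x0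
  proof -
    obtain y0 where y0: "norm y0 \<le> r" "blinfun_apply (A x0) y0 = \<alpha> x0" "y0 \<in> U"
      and x0: "x0 \<in> topspace X" using x0S by auto
    obtain e where e: "e > 0" "ball y0 e \<subseteq> U" using U y0(3) open_contains_ball by blast
    from hyperplane_ball_lower_stable[OF attained luc r nz[OF x0] y0(1,2) e(1)]
    obtain \<eta> z1 z2 where \<eta>: "\<eta> > 0" and stable: "\<And>f a. \<bar>a\<bar> \<le> r * norm f \<Longrightarrow>
      \<bar>blinfun_apply f y0 - \<alpha> x0\<bar> < \<eta> \<Longrightarrow> \<bar>blinfun_apply f z1 - blinfun_apply (A x0) z1\<bar> < \<eta> \<Longrightarrow>
      \<bar>blinfun_apply f z2 - blinfun_apply (A x0) z2\<bar> < \<eta> \<Longrightarrow> \<bar>a - \<alpha> x0\<bar> < \<eta> \<Longrightarrow>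
      \<exists>y. norm y \<le> r \<and> blinfun_apply f y = a \<and> dist y y0 < e"
      by blast
    define T where "T h = {x \<in> topspace X. h x \<in> ball (h x0) \<eta>}" for h :: "'b \<Rightarrow> real"
    have T: "openin X (T h)" if "continuous_map X euclideanreal h" for h
      unfolding T_def using that by (rule openin_continuous_map_preimage) simp
    define P where "P = T \<alpha> \<inter> T (\<lambda>x. blinfun_apply (A x) y0) \<inter>
      T (\<lambda>x. blinfun_apply (A x) z1) \<inter> T (\<lambda>x. blinfun_apply (A x) z2)"
    have "openin X P"
      unfolding P_def by (intro openin_Int T weakly_continuous_apply A \<alpha>)
    moreover have "x0 \<in> P" using x0 \<eta> by (simp add: P_def T_def)
    moreover have "x \<in> ?S" if x: "x \<in> P" for x
    proof -
      have xX: "x \<in> topspace X" using x by (simp add: P_def T_def)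
      have "\<exists>y. norm y \<le> r \<and> blinfun_apply (A x) y = \<alpha> x \<and> dist y y0 < e"
        using x bound[OF xX] y0(2)
        by (intro stable) (auto simp: P_def T_def dist_real_def abs_minus_commute)
      then obtain y where "norm y \<le> r" "blinfun_apply (A x) y = \<alpha> x" "dist y y0 < e" by blast
      moreover from this have "y \<in> U" using e(2) by (auto simp: dist_commute)
      ultimately show ?thesis using xX by blast
    qed
    ultimately show ?thesis by blast
  qed
  then show "openin X ?S" by (subst openin_subopen) blast
qed

lemma lsc_multimap_coarser:
  "lsc_multimap X T \<Psi> \<Longrightarrow> (\<And>U. openin \<tau> U \<Longrightarrow> openin T U) \<Longrightarrow> lsc_multimap X \<tau> \<Psi>"
  by (simp add: lsc_multimap_def)

text \<open>
  Near a point of \<open>C\<close> the prescribed values matter only on \<open>C\<close>, where continuity of \<open>g\<close> controls them;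
  elsewhere \<open>\<Psi>\<close> itself supplies a value. This is how a selection theorem becomes an extension theorem.
\<close>

lemma lsc_multimap_prescribe:
  assumes \<Psi>: "lsc_multimap X \<tau> \<Psi>" and C: "closedin X C"
    and g: "continuous_map (subtopology X C) \<tau> g" and sel: "\<And>x. x \<in> C \<Longrightarrow> g x \<in> \<Psi> x"
  shows "lsc_multimap X \<tau> (\<lambda>x. if x \<in> C then {g x} else \<Psi> x)"
  unfolding lsc_multimap_def
proof (intro allI impI)
  fix U assume U: "openin \<tau> U"
  have "openin (subtopology X C) {x \<in> topspace (subtopology X C). g x \<in> U}"
    using g U by (rule openin_continuous_map_preimage)
  then obtain T where T: "openin X T" "{x \<in> topspace (subtopology X C). g x \<in> U} = T \<inter> C"
    unfolding openin_subtopology by blast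
  have CX: "C \<subseteq> topspace X" using C by (rule closedin_subset)
  have TC: "x \<in> T \<longleftrightarrow> g x \<in> U" if "x \<in> C" for x
    using T(2) that CX by (auto simp: set_eq_iff)
  have TX: "T \<subseteq> topspace X" using T(1) by (rule openin_subset)
  have "{x \<in> topspace X. (if x \<in> C then {g x} else \<Psi> x) \<inter> U \<noteq> {}} =
      {x \<in> topspace X. \<Psi> x \<inter> U \<noteq> {}} \<inter> (T \<union> (topspace X - C))"
    (is "?L = ?R")
  proof (rule set_eqI)
    fix x
    show "x \<in> ?L \<longleftrightarrow> x \<in> ?R"
      using TC[of x] TX sel[of x] by (cases "x \<in> C") auto
  qed
  moreover have "openin X ?R"
    using \<Psi> U T(1) C unfolding lsc_multimap_def by (intro openin_Int openin_Un) auto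
  ultimately show "openin X ?L" by simp
qed

theorem theorem1:
  fixes \<tau> :: "'a::banach topology"
    and X :: "'b topology"
    and A :: "'b \<Rightarrow> ('a \<Rightarrow>\<^sub>L real)"
    and r :: real
    and \<alpha> :: "'b \<Rightarrow> real"
    and C :: "'b set"
    and g :: "'b \<Rightarrow> 'a"
  assumes "reflexive_space TYPE('a)"
    and "locally_uniformly_convex TYPE('a)"
    and "admissible_topology \<tau>"
    and "paracompact_space X"
    and "continuous_map X weak_topology A"
    and "r > 0"
    and "continuous_map X euclideanreal \<alpha>"
    and "\<forall>x\<in>topspace X. \<bar>\<alpha> x\<bar> \<le> r * norm (A x)"
    and "closedin X C"
    and "continuous_map (subtopology X C) (subtopology \<tau> (cball 0 r)) g"
    and "\<forall>x\<in>C. blinfun_apply (A x) (g x) = \<alpha> x"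
    and "\<forall>\<psi>. continuous_map X (subtopology \<tau> (cball 0 r)) \<psi> \<and> (\<forall>x\<in>C. \<psi> x = g x) \<longrightarrow>
           (\<exists>x0\<in>topspace X. blinfun_apply (A x0) (\<psi> x0) \<noteq> \<alpha> x0)"
  shows "\<exists>x\<in>topspace X. A x = 0"
proof (rule ccontr)
  assume "\<not> ?thesis"
  then have nz: "\<And>x. x \<in> topspace X \<Longrightarrow> A x \<noteq> 0" by blast
  have \<tau>: "Hausdorff_lctvs \<tau>" and coarser: "\<And>U. openin \<tau> U \<Longrightarrow> open U"
    and finer: "\<And>U :: 'a set. openin weak_topology U \<Longrightarrow> openin \<tau> U"
    and metr: "completely_metrizable_space (subtopology \<tau> (cball 0 1))"
    using assms(3) by (auto simp: admissible_topology_def)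
  have attained: "\<exists>z. norm z \<le> 1 \<and> blinfun_apply f z = norm f" for f :: "'a \<Rightarrow>\<^sub>L real"
    using reflexive_norm_attained[OF assms(1), of f] by blast
  have gC: "continuous_map (subtopology X C) \<tau> g" "\<And>x. x \<in> C \<Longrightarrow> norm (g x) \<le> r"
    using assms(10) closedin_subset[OF assms(9)] by (auto simp: continuous_map_in_subtopology)
  have "first_countable (subtopology \<tau> (cball 0 1))"
    using metr by (intro metrizable_imp_first_countable completely_metrizable_imp_metrizable_space)
  moreover have "2 * r > 0" using assms(6) by simp
  ultimately obtain V where V: "\<And>n::nat. symmetric_convex_nhd \<tau> (V n)"
    "\<And>n u v. u \<in> V (Suc n) \<Longrightarrow> v \<in> V (Suc n) \<Longrightarrow> u + v \<in> V n"
    "\<And>W. openin \<tau> W \<Longrightarrow> 0 \<in> W \<Longrightarrow> \<exists>n. V n \<inter> cball 0 (2 * r) \<subseteq> W"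
    using lctvs_countable_base_on_ball[OF \<tau>] by metis
  define \<Phi> where "\<Phi> x = {y. norm y \<le> r \<and> blinfun_apply (A x) y = \<alpha> x}" for x
  define \<Psi> where "\<Psi> x = (if x \<in> C then {g x} else \<Phi> x)" for x
  have "lsc_multimap X euclidean \<Phi>"
    unfolding \<Phi>_def using assms(8) by (intro hyperplane_ball_lsc attained assms nz) auto
  then have "lsc_multimap X \<tau> \<Phi>" by (rule lsc_multimap_coarser) (simp add: coarser)
  then have lsc: "lsc_multimap X \<tau> \<Psi>"
    unfolding \<Psi>_def
    by (rule lsc_multimap_prescribe[OF _ assms(9) gC(1)]) (use gC(2) assms(11) in \<open>simp add: \<Phi>_def\<close>)
  have \<Phi>_ne: "\<Phi> x \<noteq> {}" if x: "x \<in> topspace X" for x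
  proof -
    obtain z where z: "norm z \<le> 1" "blinfun_apply (A x) z = norm (A x)" using attained by blast
    let ?c = "\<alpha> x / norm (A x)"
    have "\<bar>?c\<bar> \<le> r" using assms(8) x nz[OF x] by (simp add: divide_le_eq)
    then have "\<bar>?c\<bar> * norm z \<le> r * 1" using z(1) assms(6) by (intro mult_mono) auto
    then have "?c *\<^sub>R z \<in> \<Phi> x" using z(2) nz[OF x] by (simp add: \<Phi>_def blinfun.scaleR_right)
    then show ?thesis by blast
  qed
  have "\<Phi> x = cball 0 r \<inter> blinfun_apply (A x) -` {\<alpha> x}" for x by (auto simp: \<Phi>_def)
  then have \<Phi>_conv: "convex (\<Phi> x)" for x
    by (simp add: convex_Int convex_linear_vimage bounded_linear.linear blinfun.bounded_linear_right)
  have base: "\<exists>n. \<forall>u\<in>cball 0 r. \<forall>v\<in>cball 0 r. u - v \<in> V n \<longrightarrow> u - v \<in> W"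
    if W: "openin \<tau> W" "0 \<in> W" for W
  proof -
    obtain n where n: "V n \<inter> cball 0 (2 * r) \<subseteq> W" using V(3)[OF W] by blast
    have "norm (u - v) \<le> 2 * r" if "u \<in> cball 0 r" "v \<in> cball 0 r" for u v :: 'a
      using norm_triangle_ineq4[of u v] that by simp
    then show ?thesis using n by (intro exI[of _ n]) auto
  qed
  have complete: "\<exists>z\<in>cball 0 r. \<forall>k. \<exists>N. \<forall>n\<ge>N. y n - z \<in> V k"
    if y: "\<And>n::nat. y n \<in> cball 0 r" "\<And>k. \<exists>N. \<forall>m\<ge>N. \<forall>n\<ge>N. y m - y n \<in> V k" for y
  proof -
    have "norm (y n) \<le> r" for n using y(1)[of n] by simp
    from admissible_ball_sequentially_complete[OF assms(1) finer coarser V(1,2,3) this y(2)]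
    obtain z where "norm z \<le> r" "\<forall>k. \<exists>N. \<forall>n\<ge>N. y n - z \<in> V k" by blast
    then show ?thesis by (intro bexI[of _ z]) auto
  qed
  obtain F where F: "continuous_map X \<tau> F" "\<And>x. x \<in> topspace X \<Longrightarrow> F x \<in> cball 0 r"
    "\<And>x k. x \<in> topspace X \<Longrightarrow> \<exists>y\<in>\<Psi> x. F x - y \<in> V k"
  proof (rule convex_selection[OF assms(4) \<tau> V(1,2) convex_cball base complete lsc])
    fix x assume "x \<in> topspace X"
    then show "convex (\<Psi> x)" "\<Psi> x \<noteq> {}" "\<Psi> x \<subseteq> cball 0 r"
      using \<Phi>_conv \<Phi>_ne gC(2) by (auto simp: \<Psi>_def \<Phi>_def)
  qed auto
  \<comment> \<open>A functional that is constant on \<open>\<Psi> x\<close> takes the same value at \<open>F x\<close>; applied to \<open>A x\<close> it puts \<open>F x\<close> on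
    the hyperplane, and applied to all functionals it identifies \<open>F x\<close> with \<open>g x\<close> on \<open>C\<close>.\<close>
  have eval_F: "blinfun_apply f (F x) = c"
    if x: "x \<in> topspace X" and c: "\<And>y. y \<in> \<Psi> x \<Longrightarrow> blinfun_apply f y = c" for f :: "'a \<Rightarrow>\<^sub>L real" and x c
  proof (rule ccontr)
    assume "blinfun_apply f (F x) \<noteq> c"
    then have e: "\<bar>blinfun_apply f (F x) - c\<bar> > 0" by simp
    let ?W = "blinfun_apply f -` ball 0 \<bar>blinfun_apply f (F x) - c\<bar>"
    have "openin \<tau> ?W" by (intro finer openin_weak_topology_vimage open_ball)
    moreover have "0 \<in> ?W" using e by (simp add: blinfun.zero_right)
    ultimately obtain k where k: "V k \<inter> cball 0 (2 * r) \<subseteq> ?W" using V(3) by blast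
    obtain y where y: "y \<in> \<Psi> x" "F x - y \<in> V k" using F(3)[OF x] by blast
    have "norm y \<le> r" using y(1) gC(2) by (auto simp: \<Psi>_def \<Phi>_def split: if_splits)
    then have "norm (F x - y) \<le> 2 * r"
      using norm_triangle_ineq4[of "F x" y] F(2)[OF x] by simp
    then have "F x - y \<in> ?W" using k y(2) by auto
    then show False using c[OF y(1)] by (simp add: blinfun.diff_right)
  qed
  have Fg: "F x = g x" if x: "x \<in> C" for x
  proof -
    have xX: "x \<in> topspace X" using x closedin_subset[OF assms(9)] by blast
    obtain f :: "'a \<Rightarrow>\<^sub>L real" where f: "blinfun_apply f (F x - g x) = norm (F x - g x)"
      using norming_functional by blast
    have "blinfun_apply f (F x) = blinfun_apply f (g x)"
      by (rule eval_F[OF xX]) (use x in \<open>simp add: \<Psi>_def\<close>)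
    then show ?thesis using f by (simp add: blinfun.diff_right)
  qed
  have "blinfun_apply (A x) (F x) = \<alpha> x" if x: "x \<in> topspace X" for x
    by (rule eval_F[OF x]) (use assms(11) in \<open>auto simp: \<Psi>_def \<Phi>_def split: if_splits\<close>)
  moreover have "continuous_map X (subtopology \<tau> (cball 0 r)) F"
    using F(1,2) by (auto simp: continuous_map_in_subtopology)
  ultimately show False using assms(12) Fg by blast
qed

end
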